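(* Let $p$ be an odd prime, $Sp=SL_2(\mathbb{F}_p)$, $A\subset Sp$ the diagonal torus, and for $b,c\in\mathbb{F}_p$ put $g_{b,c}=\begin{pmatrix}1&b\\c&1+bc\end{pmatrix}$. Then every split torus in $Sp$ equals $g_{b,c}Ag_{b,c}^{-1}$ for some $b,c\in\mathbb{F}_p$. Let $R$ be a set of matrices of the form $g_{b,c}$ such that every split torus equals $gAg^{-1}$ for exactly one $g\in R$. Then the split oscillator system $\mathfrak{S}_O^s$ is, up to multiplication of its members by unitary scalars, equal to $$\{\rho(g)\varphi:\ g\in R,\ \varphi\in\mathcal{B}_A\},$$ and, up to a unitary scalar, $\rho(g_{b,c})=M_{\frac{1+bc}{b}}\circ S_b\circ F\circ M_{b^{-1}}$ if $b\ne0$, and $\rho(g_{0,c})=M_c$.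
   Context: Let $\mathcal{H}=\mathbb{C}(\mathbb{F}_p)$ with $\langle\phi,\varphi\rangle=\sum_t\phi(t)\overline{\varphi(t)}$, $\psi(t)=e^{2\pi i t/p}$, and let $\sigma_0$ be the Legendre character of $\mathbb{F}_p^\times$. Define operators on $\mathcal{H}$: $S_a[f](t)=\sigma_0(a)f(a^{-1}t)$ for $a\in\mathbb{F}_p^\times$; $M_u[f](t)=\psi(-\tfrac u2t^2)f(t)$ for $u\in\mathbb{F}_p$; $F[f](w)=\frac1{\sqrt p}\sum_{t\in\mathbb{F}_p}\psi(wt)f(t)$. Let $\mathsf{L}_\tau f(t)=f(t+\tau)$, $\mathsf{M}_wf(t)=\psi(wt)f(t)$. The Heisenberg group $H=\mathbb{F}_p^3$ with $(\tau,w,z)(\tau',w',z')=(\tau+\tau',w+w',z+z'+\tfrac12(\tau w'-\tau'w))$ acts on $\mathcal{H}$ by $\pi(\tau,w,z)=\psi(\tfrac12\tau w+z)\mathsf{M}_w\mathsf{L}_\tau$, and $Sp$ acts on $H$ through its linear action on the column vector $(\tau,w)$. The Weil representation $\rho:Sp\to U(\mathcal{H})$ is the unitary representation with $\rho(g)\pi(h)\rho(g)^{-1}=\pi(g(h))$ for all $g\in Sp$, $h\in H$ (unique if $p>3$; for $p=3$ take the one with $\mathrm{Tr}(\rho(g)\pi(-v))=\sigma_0(-\det(\kappa(g)+I))\,\psi(\tfrac14\omega(\kappa(g)v,v))$ for $v\in\mathbb{F}_p^2$ whenever $g-I$ is invertible, where $\omega((\tau,w),(\tau',w'))=\tau w'-\tau'w$,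 $\kappa(g)=(g+I)(g-I)^{-1}$). A split torus is a subgroup of $Sp$ conjugate to $A=\{\mathrm{diag}(a,a^{-1}):a\in\mathbb{F}_p^\times\}$. For a split torus $T$ with character group $T^\vee$ and unique order-2 character $\sigma$, the space $\mathcal{H}_\chi=\{\varphi:\rho(g)\varphi=\chi(g)\varphi\ \forall g\in T\}$ is one-dimensional for $\chi\ne\sigma$; choose unit vectors $\varphi_\chi\in\mathcal{H}_\chi$ and set $\mathcal{B}_T=\{\varphi_\chi:\chi\in T^\vee,\chi\ne\sigma\}$. The split oscillator system is $\mathfrak{S}_O^s=\bigcup_{T\text{ split}}\mathcal{B}_T$. *)

theory Defs
  imports "HOL-Analysis.Analysis" "HOL-Number_Theory.Residues" "Berlekamp_Zassenhaus.Finite_Field"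
begin

(* 'p mod_ring with 'p :: prime_card is the field F_p, p = CARD('p). *)

type_synonym 'p plane = "('p mod_ring)^2"
type_synonym 'p mat2 = "('p mod_ring)^2^2"
type_synonym 'p hilb = "complex^('p mod_ring)"

definition psi :: "'p::prime_card mod_ring \<Rightarrow> complex" where
  "psi t = exp (2 * of_real pi * \<i> * of_int (to_int_mod_ring t) / of_nat CARD('p))"

definition sigma0 :: "'p::prime_card mod_ring \<Rightarrow> complex" where
  "sigma0 a = of_int (Legendre (to_int_mod_ring a) (int CARD('p)))"

definition herm :: "'p::prime_card hilb \<Rightarrow> 'p hilb \<Rightarrow> complex" where
  "herm f g = (\<Sum>t\<in>UNIV. f $ t * cnj (g $ t))"

definition unitary_op :: "('p::prime_card hilb \<Rightarrow> 'p hilb) \<Rightarrow> bool" where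
  "unitary_op U \<longleftrightarrow> Vector_Spaces.linear (*s) (*s) U \<and> bij U \<and> (\<forall>f g. herm (U f) (U g) = herm f g)"

definition S_op :: "'p::prime_card mod_ring \<Rightarrow> 'p hilb \<Rightarrow> 'p hilb" where
  "S_op a f = (\<chi> t. sigma0 a * f $ (inverse a * t))"

definition M_op :: "'p::prime_card mod_ring \<Rightarrow> 'p hilb \<Rightarrow> 'p hilb" where
  "M_op u f = (\<chi> t. psi (- (u / 2) * t^2) * f $ t)"

definition F_op :: "'p::prime_card hilb \<Rightarrow> 'p hilb" where
  "F_op f = (\<chi> w. of_real (1 / sqrt (real CARD('p))) * (\<Sum>t\<in>UNIV. psi (w * t) * f $ t))"

definition shift_op :: "'p::prime_card mod_ring \<Rightarrow> 'p hilb \<Rightarrow> 'p hilb" where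
  "shift_op \<tau> f = (\<chi> t. f $ (t + \<tau>))"

definition modulation_op :: "'p::prime_card mod_ring \<Rightarrow> 'p hilb \<Rightarrow> 'p hilb" where
  "modulation_op w f = (\<chi> t. psi (w * t) * f $ t)"

type_synonym 'p heis = "'p mod_ring \<times> 'p mod_ring \<times> 'p mod_ring"

fun heis_rep :: "'p::prime_card heis \<Rightarrow> 'p hilb \<Rightarrow> 'p hilb" where
  "heis_rep (\<tau>, w, z) = (\<lambda>f. psi (1/2 * \<tau> * w + z) *s modulation_op w (shift_op \<tau> f))"

definition Sp :: "'p::prime_card mat2 set" where
  "Sp = {g. det g = 1}"

fun heis_act :: "'p::prime_card mat2 \<Rightarrow> 'p heis \<Rightarrow> 'p heis" where
  "heis_act g (\<tau>, w, z) = (let v = g *v vector [\<tau>, w] in (v $ 1, v $ 2, z))"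

definition omega :: "'p::prime_card plane \<Rightarrow> 'p plane \<Rightarrow> 'p mod_ring" where
  "omega v v' = v $ 1 * v' $ 2 - v' $ 1 * v $ 2"

definition kappa :: "'p::prime_card mat2 \<Rightarrow> 'p mat2" where
  "kappa g = (g + mat 1) ** matrix_inv (g - mat 1)"

definition op_trace :: "('p::prime_card hilb \<Rightarrow> 'p hilb) \<Rightarrow> complex" where
  "op_trace U = trace (matrix U)"

(* The values of \<rho> outside Sp are irrelevant.  The intertwining property determines \<rho> on Sp
   only for p > 3; the trace formula singles out one solution when p = 3. *)
definition weil_representation :: "('p::prime_card mat2 \<Rightarrow> 'p hilb \<Rightarrow> 'p hilb) \<Rightarrow> bool" where
  "weil_representation \<rho> \<longleftrightarrow>
     (\<forall>g\<in>Sp. unitary_op (\<rho> g)) \<and>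
     (\<forall>g\<in>Sp. \<forall>h\<in>Sp. \<rho> (g ** h) = \<rho> g \<circ> \<rho> h) \<and>
     (\<forall>g\<in>Sp. \<forall>h. \<rho> g \<circ> heis_rep h \<circ> inv_into UNIV (\<rho> g) = heis_rep (heis_act g h)) \<and>
     (CARD('p) = 3 \<longrightarrow>
        (\<forall>g\<in>Sp. invertible (g - mat 1) \<longrightarrow>
          (\<forall>v. op_trace (\<rho> g \<circ> heis_rep (- v $ 1, - v $ 2, 0)) =
               sigma0 (- det (kappa g + mat 1)) * psi (1/4 * omega (kappa g *v v) v))))"

definition diag_torus :: "'p::prime_card mat2 set" where
  "diag_torus = {vector [vector [a, 0], vector [0, inverse a]] | a. a \<noteq> 0}"

definition conj_set :: "'p::prime_card mat2 \<Rightarrow> 'p mat2 set \<Rightarrow> 'p mat2 set" where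
  "conj_set g T = (\<lambda>x. g ** x ** matrix_inv g) ` T"

definition split_torus :: "'p::prime_card mat2 set \<Rightarrow> bool" where
  "split_torus T \<longleftrightarrow> (\<exists>g\<in>Sp. T = conj_set g diag_torus)"

(* Written \<eta>, since \<chi> is the vector binder.  Extensional functions, so that a character of T is a single HOL function. *)
definition characters :: "'p::prime_card mat2 set \<Rightarrow> ('p mat2 \<Rightarrow> complex) set" where
  "characters T = {\<eta> \<in> T \<rightarrow>\<^sub>E - {0}. \<forall>x\<in>T. \<forall>y\<in>T. \<eta> (x ** y) = \<eta> x * \<eta> y}"

definition order2_char :: "'p::prime_card mat2 set \<Rightarrow> 'p mat2 \<Rightarrow> complex" where
  "order2_char T = (THE \<eta>. \<eta> \<in> characters T \<and> (\<exists>x\<in>T. \<eta> x \<noteq> 1) \<and> (\<forall>x\<in>T. \<eta> x ^ 2 = 1))"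

definition eigenspace ::
  "('p::prime_card mat2 \<Rightarrow> 'p hilb \<Rightarrow> 'p hilb) \<Rightarrow> 'p mat2 set \<Rightarrow> ('p mat2 \<Rightarrow> complex) \<Rightarrow> 'p hilb set" where
  "eigenspace \<rho> T \<eta> = {f. \<forall>g\<in>T. \<rho> g f = \<eta> g *s f}"

type_synonym 'p eigen_choice = "'p mat2 set \<Rightarrow> ('p mat2 \<Rightarrow> complex) \<Rightarrow> 'p hilb"

definition unit_eigenvectors ::
  "('p::prime_card mat2 \<Rightarrow> 'p hilb \<Rightarrow> 'p hilb) \<Rightarrow> 'p eigen_choice \<Rightarrow> bool" where
  "unit_eigenvectors \<rho> \<phi> \<longleftrightarrow>
     (\<forall>T \<eta>. split_torus T \<and> \<eta> \<in> characters T \<and> \<eta> \<noteq> order2_char T \<longrightarrow>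
        \<phi> T \<eta> \<in> eigenspace \<rho> T \<eta> \<and> herm (\<phi> T \<eta>) (\<phi> T \<eta>) = 1)"

definition torus_basis :: "'p::prime_card eigen_choice \<Rightarrow> 'p mat2 set \<Rightarrow> 'p hilb set" where
  "torus_basis \<phi> T = {\<phi> T \<eta> | \<eta>. \<eta> \<in> characters T \<and> \<eta> \<noteq> order2_char T}"

definition split_oscillator_system :: "'p::prime_card eigen_choice \<Rightarrow> 'p hilb set" where
  "split_oscillator_system \<phi> = (\<Union>T\<in>{T. split_torus T}. torus_basis \<phi> T)"

definition g_mat :: "'p::prime_card mod_ring \<Rightarrow> 'p mod_ring \<Rightarrow> 'p mat2" where
  "g_mat b c = vector [vector [1, b], vector [c, 1 + b * c]]"

definition eq_up_to_unitary_scalar ::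
  "('p::prime_card hilb \<Rightarrow> 'p hilb) \<Rightarrow> ('p hilb \<Rightarrow> 'p hilb) \<Rightarrow> bool" where
  "eq_up_to_unitary_scalar U V \<longleftrightarrow> (\<exists>\<zeta>. cmod \<zeta> = 1 \<and> U = (\<lambda>f. \<zeta> *s V f))"

end

(*
  By Schur's lemma for the Heisenberg representation, rho(g) is determined up to a scalar by its
  intertwining relation, and M_c, S_a, F intertwine for [[1,0],[c,1]], diag(a,1/a), [[0,1],[-1,0]];
  the formula for rho(g_{b,c}) then follows from factoring g_{b,c}.  The scalar matters only on the
  diagonal torus, where rho(diag(a,1/a)) = S_a exactly: for p = 3 by the trace formula at -1, and
  for p > 3 by writing rho(w u) = rho(g_{b,0} w) on constants, which compares the Gauss sums of the
  forms b t^2/2 and t^2/2.  Hence the eigenspaces of S_a away from the Legendre character are lines,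
  and rho(g) carries those of A to those of g A g^{-1}.
*)

theory Submission
  imports Defs
begin

subsection \<open>The additive and the quadratic character of the prime field\<close>

text \<open>The torus must be normalised exactly because of the point mass at 0. It is an
  eigenvector of every \<open>S_op a\<close> with eigenvalue \<open>sigma0 a\<close>, and so is the
  function equal to 1 off 0 and to 0 at 0; thus the Legendre eigenspace is a plane, the others at
  most lines. If \<open>\<rho>\<close> differed from \<open>S_op\<close> on the torus by a
  nontrivial character, this plane would belong to a character that is not excluded, and a unit
  vector in it would not be fixed up to a phase. The prime 3 stands apart because the scalars on the
  lower unipotent group form an additive character that conjugation by the torus makes invariant
  under multiplication by nonzero squares. For p > 3 the square 4 differs from 1 and the character
  is trivial; for p = 3 the only nonzero square is 1, the invariance says nothing, and the trace
  formula supplies the normalisation instead. The parameter \<open>a\<close> of a point of g A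
  g^{-1} depends on g and not only on the torus, since the Weyl element normalises A and inverts
  \<open>a\<close>. One representative per torus in R makes the transported character, and with it
  the phase, a function of the pair (T, \<eta>).\<close>

lemma psi_of_int: "psi (of_int n :: 'p::prime_card mod_ring) = exp (2 * of_real pi * \<i> * of_int n / of_nat CARD('p))"
proof -
  let ?p = "int CARD('p)"
  have p: "of_nat CARD('p) \<noteq> (0::complex)" by simp
  have "to_int_mod_ring (of_int n :: 'p mod_ring) = n mod ?p"
    by (simp add: of_int_of_int_mod_ring of_int_mod_ring.rep_eq to_int_mod_ring.rep_eq)
  moreover have "of_int n = (of_int (n mod ?p) + of_int (n div ?p) * of_nat CARD('p) :: complex)"
    by (metis mod_div_mult_eq of_int_add of_int_mult of_int_of_nat_eq)
  hence "2 * of_real pi * \<i> * of_int n / of_nat CARD('p) =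
     2 * of_real pi * \<i> * of_int (n mod ?p) / of_nat CARD('p) + \<i> * (of_int (n div ?p) * (of_real pi * 2))"
    using p by (simp add: field_simps)
  moreover have "exp (\<i> * (of_int (n div ?p) * (of_real pi * 2))) = (1::complex)"
    by (auto simp: exp_eq_1)
  ultimately show ?thesis
    by (simp add: psi_def exp_add)
qed

lemma of_int_to_int_mod_ring: "of_int (to_int_mod_ring a) = (a :: 'p::prime_card mod_ring)"
  by (simp add: of_int_of_int_mod_ring)

lemma psi_0 [simp]: "psi 0 = 1"
  using psi_of_int[of 0] by simp

text \<open>\<open>psi_of_int\<close> admits every integer representative, so exponents add without
  reduction modulo p.\<close>

lemma psi_add: "psi (a + b :: 'p::prime_card mod_ring) = psi a * psi b"
proof -
  have "psi (of_int m + of_int n :: 'p mod_ring) = psi (of_int m :: 'p mod_ring) * psi (of_int n :: 'p mod_ring)" for m n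
    unfolding of_int_add[symmetric] psi_of_int
    by (simp add: exp_add[symmetric] field_simps)
  thus ?thesis by (metis of_int_to_int_mod_ring)
qed

lemma cmod_psi [simp]: "cmod (psi a) = 1"
  unfolding psi_def by (simp add: norm_exp_eq_Re)

lemma psi_nonzero [simp]: "psi a \<noteq> 0"
  by (metis cmod_psi norm_zero zero_neq_one)

lemma psi_eq_1_iff: "psi a = 1 \<longleftrightarrow> a = (0 :: 'p::prime_card mod_ring)"
proof
  assume h: "psi a = 1"
  let ?n = "to_int_mod_ring a"
  have r: "0 \<le> ?n" "?n < int CARD('p)"
    using range_to_int_mod_ring[where 'a='p] by (auto simp: set_eq_iff image_iff)
  obtain k :: int where "2 * pi * ?n / real CARD('p) = of_int (2*k) * pi"
    using h unfolding psi_def exp_eq_1 by auto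
  hence "real_of_int ?n = real_of_int (k * int CARD('p))" by (simp add: field_simps)
  hence "?n = k * int CARD('p)" by linarith
  hence "?n = 0" using r by (metis mod_mult_self2_is_0 mod_pos_pos_trivial)
  thus "a = 0" by (metis of_int_to_int_mod_ring of_int_0)
qed simp

lemma sum_psi: "(\<Sum>t\<in>UNIV. psi (w * t :: 'p::prime_card mod_ring)) = (if w = 0 then of_nat CARD('p) else 0)"
proof (cases "w = 0")
  case False
  let ?S = "\<Sum>t\<in>UNIV. psi (w * t :: 'p::prime_card mod_ring)"
  \<comment> \<open>Translating the summation variable by 1 multiplies the sum by
    \<open>psi w\<close>, which is not 1.\<close>
  have "?S = (\<Sum>t\<in>UNIV. psi (w * (t + 1)))"
    by (rule sum.reindex_bij_witness[of _ "\<lambda>t. t + 1" "\<lambda>t. t - 1"]) auto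
  also have "\<dots> = psi w * ?S"
    by (simp add: distrib_left psi_add sum_distrib_left mult.commute)
  finally have "(1 - psi w) * ?S = 0" by (simp add: algebra_simps)
  thus ?thesis using False psi_eq_1_iff[of w] by auto
qed simp

lemma two_nonzero:
  assumes "odd CARD('p::prime_card)"
  shows "(2 :: 'p mod_ring) \<noteq> 0"
proof
  assume "(2 :: 'p mod_ring) = 0"
  hence "CARD('p) dvd 2" using of_nat_0_mod_ring_dvd[of 2, where 'a='p] by simp
  thus False using assms prime_card[where 'a='p]
    by (metis primes_dvd_imp_eq two_is_prime_nat)
qed

lemma sigma0_eq: "sigma0 (a :: 'p::prime_card mod_ring) = (if a = 0 then 0 else if \<exists>y. a = y^2 then 1 else - 1)"
proof -
  let ?p = "int CARD('p)"
  have c: "[m = n] (mod ?p) \<longleftrightarrow> (of_int m :: 'p mod_ring) = of_int n" for m n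
    by (simp add: of_int_eq_iff_cong_CHAR)
  have 1: "[to_int_mod_ring a = 0] (mod ?p) \<longleftrightarrow> a = 0"
    unfolding c by (simp add: of_int_to_int_mod_ring)
  have 2: "QuadRes ?p (to_int_mod_ring a) \<longleftrightarrow> (\<exists>y. a = y^2)"
    unfolding QuadRes_def c of_int_power of_int_to_int_mod_ring by (metis of_int_to_int_mod_ring)
  show ?thesis unfolding sigma0_def Legendre_def 1 2 by simp
qed

definition unit_squares :: "'p::prime_card mod_ring set" where
  "unit_squares = {s. s \<noteq> 0 \<and> (\<exists>y. s = y^2)}"

text \<open>Squaring is two-to-one on the units, as y and -y differ in odd characteristic. Applied
  to the constant 1 this also counts the unit squares.\<close>

lemma sum_over_unit_squares:
  fixes f :: "'p::prime_card mod_ring \<Rightarrow> complex"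
  assumes "odd CARD('p)"
  shows "(\<Sum>t\<in>UNIV - {0}. f (t^2)) = 2 * (\<Sum>s\<in>unit_squares. f s)"
proof -
  let ?U = "UNIV - {0 :: 'p mod_ring}"
  have im: "(\<lambda>t. t^2) ` ?U = unit_squares"
    by (auto simp: unit_squares_def)
  have "(\<Sum>x\<in>{x \<in> ?U. x^2 = s}. f (x^2)) = 2 * f s" if s: "s \<in> unit_squares" for s
  proof -
    obtain y where y: "s = y^2" "y \<noteq> 0" using s by (auto simp: unit_squares_def)
    have ne: "y \<noteq> - y" 
    proof
      assume "y = - y"
      hence "2 * y = 0" by (metis add.right_inverse mult_2)
      thus False using y two_nonzero[OF assms] by simp
    qed
    have eq: "{x \<in> ?U. x^2 = s} = {y, - y}" using y by (auto simp: power2_eq_iff)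
    show ?thesis unfolding eq using ne y by simp
  qed
  hence "(\<Sum>s\<in>unit_squares. \<Sum>x\<in>{x \<in> ?U. x^2 = s}. f (x^2)) = (\<Sum>s\<in>unit_squares. 2 * f s)"
    by (intro sum.cong) auto
  thus ?thesis
    using sum.image_gen[of ?U "\<lambda>t. f (t^2)" "\<lambda>t. t^2"]
    unfolding im by (simp add: sum_distrib_left)
qed

text \<open>Counting takes the place of the cyclic structure of the unit group: the squares make up
  half of the units, their multiples by n are equally many and disjoint from them, so both halves
  together exhaust the units.\<close>

lemma units_eq_squares_Un_multiples:
  fixes n :: "'p::prime_card mod_ring"
  assumes "odd CARD('p)" and n: "\<nexists>y. n = y^2"
  shows "unit_squares \<inter> (*) n ` unit_squares = {}"
    and "unit_squares \<union> (*) n ` unit_squares = UNIV - {0}"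
proof -
  have n0: "n \<noteq> 0" using n by (metis zero_power2)
  show disj: "unit_squares \<inter> (*) n ` unit_squares = {}"
  proof -
    have False if "x^2 = n * y^2" "y \<noteq> 0" for x y
    proof -
      have "n = (x / y)^2" using that by (simp add: power_divide)
      thus False using n by blast
    qed
    thus ?thesis by (fastforce simp: unit_squares_def)
  qed
  have "complex_of_nat (card (UNIV - {0 :: 'p mod_ring})) = 2 * of_nat (card (unit_squares :: 'p mod_ring set))"
    using sum_over_unit_squares[OF assms(1), of "\<lambda>_. 1"] by simp
  hence "card (UNIV - {0 :: 'p mod_ring}) = 2 * card (unit_squares :: 'p mod_ring set)"
    by (metis of_nat_eq_iff of_nat_mult of_nat_numeral)
  moreover have "card ((*) n ` unit_squares) = card (unit_squares :: 'p mod_ring set)"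
    using n0 by (intro card_image) (auto simp: inj_on_def)
  ultimately have "card (UNIV - {0 :: 'p mod_ring}) = card (unit_squares \<union> (*) n ` unit_squares)"
    using disj by (simp add: card_Un_disjoint)
  thus "unit_squares \<union> (*) n ` unit_squares = UNIV - {0}"
    using n0 by (intro card_subset_eq) (auto simp: unit_squares_def)
qed

lemma nonsquare_eq_nonsquare_mult_square:
  fixes m n :: "'p::prime_card mod_ring"
  assumes "odd CARD('p)" and "\<nexists>y. n = y^2" and "\<nexists>y. m = y^2"
  obtains y where "y \<noteq> 0" and "m = n * y^2"
proof -
  have "m \<noteq> 0" using assms(3) by (metis zero_power2)
  hence "m \<in> unit_squares \<union> (*) n ` unit_squares"
    using units_eq_squares_Un_multiples(2)[OF assms(1,2)] by simp
  thus ?thesis using assms(3) that by (auto simp: unit_squares_def)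
qed

text \<open>For a square n this is a substitution. For a nonsquare n the values t^2 and n t^2
  together cover every unit twice, so the two Gauss sums add up to twice a full character sum, which
  is 0.\<close>

lemma gauss_sum_mult:
  fixes n k :: "'p::prime_card mod_ring"
  assumes "odd CARD('p)" and "n \<noteq> 0" and k: "k \<noteq> 0"
  shows "(\<Sum>t\<in>UNIV. psi (k * (n * t^2))) = sigma0 n * (\<Sum>t\<in>UNIV. psi (k * t^2))"
proof (cases "\<exists>y. n = y^2")
  case True
  then obtain y where y: "n = y^2" by blast
  have "(\<Sum>t\<in>UNIV. psi (k * (n * t^2))) = (\<Sum>t\<in>UNIV. psi (k * t^2))"
    using assms(2) y
    by (intro sum.reindex_bij_witness[of _ "\<lambda>t. t / y" "\<lambda>t. y * t"]) (auto simp: power_mult_distrib)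
  thus ?thesis using True assms(2) by (simp add: sigma0_eq)
next
  case False
  let ?f = "\<lambda>s. psi (k * s)"
  let ?Q = "unit_squares :: 'p mod_ring set"
  note part = units_eq_squares_Un_multiples[OF assms(1) False]
  have split0: "(\<Sum>t\<in>UNIV. g t) = g 0 + (\<Sum>t\<in>UNIV - {0}. g t)" for g :: "'p mod_ring \<Rightarrow> complex"
    by (rule sum.remove) auto
  have "(\<Sum>t\<in>UNIV - {0}. ?f (t^2)) + (\<Sum>t\<in>UNIV - {0}. ?f (n * t^2)) =
      2 * (\<Sum>s\<in>?Q. ?f s) + 2 * (\<Sum>s\<in>?Q. ?f (n * s))"
    by (simp only: sum_over_unit_squares[OF assms(1), of ?f]
        sum_over_unit_squares[OF assms(1), of "\<lambda>s. ?f (n * s)"])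
  also have "(\<Sum>s\<in>?Q. ?f (n * s)) = (\<Sum>s\<in>(*) n ` ?Q. ?f s)"
    using assms(2) by (subst sum.reindex) (auto simp: inj_on_def)
  also have "2 * (\<Sum>s\<in>?Q. ?f s) + 2 * (\<Sum>s\<in>(*) n ` ?Q. ?f s) = 2 * (\<Sum>s\<in>UNIV - {0}. ?f s)"
    unfolding part(2)[symmetric] using part(1) by (simp add: sum.union_disjoint)
  \<comment> \<open>The terms at t = 0 of the two Gauss sums supply the two copies of
    \<open>?f 0\<close> that the sums over units leave out.\<close>
  finally have "(\<Sum>t\<in>UNIV. ?f (t^2)) + (\<Sum>t\<in>UNIV. ?f (n * t^2)) = 2 * (\<Sum>s\<in>UNIV. ?f s)"
    unfolding split0[of "\<lambda>t. ?f (t^2)"] split0[of "\<lambda>t. ?f (n * t^2)"] split0[of ?f] by simp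
  also have "\<dots> = 0" using k by (simp add: sum_psi)
  finally show ?thesis using False assms(2) by (simp add: sigma0_eq eq_neg_iff_add_eq_0 add.commute)
qed

subsection \<open>Intertwining operators and Schur's lemma\<close>

lemma mat2_eq_iff: "A = B \<longleftrightarrow> A$1$1 = B$1$1 \<and> A$1$2 = B$1$2 \<and> A$2$1 = B$2$1 \<and> A$2$2 = B$2$2"
  for A B :: "'a^2^2"
  by (auto simp: vec_eq_iff forall_2)

lemma mat2_mult_nth: "(A ** B) $ i $ j = A$i$1 * B$1$j + A$i$2 * B$2$j"
  for A B :: "'a::semiring_1^2^2"
  by (simp add: matrix_matrix_mult_def sum_2)

lemma mat_1_nth [simp]: "(mat 1 :: 'a::zero_neq_one^2^2)$1$1 = 1" "(mat 1 :: 'a^2^2)$1$2 = 0"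
  "(mat 1 :: 'a^2^2)$2$1 = 0" "(mat 1 :: 'a^2^2)$2$2 = 1"
  by (simp_all add: mat_def)

lemma Sp_mult [intro]: "g \<in> Sp \<Longrightarrow> h \<in> Sp \<Longrightarrow> g ** h \<in> Sp"
  by (simp add: Sp_def det_mul)

lemma mat_1_Sp [intro, simp]: "mat 1 \<in> Sp"
  by (simp add: Sp_def)

definition diag_elt :: "'p::prime_card mod_ring \<Rightarrow> 'p mat2" where
  "diag_elt a = vector [vector [a, 0], vector [0, inverse a]]"

definition weyl_elt :: "'p::prime_card mat2" where
  "weyl_elt = vector [vector [0, 1], vector [- 1, 0]]"

lemma diag_elt_nth [simp]: "diag_elt a $1$1 = a" "diag_elt a $1$2 = 0" "diag_elt a $2$1 = 0"
  "diag_elt a $2$2 = inverse a"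
  by (simp_all add: diag_elt_def)

lemma weyl_elt_nth [simp]: "weyl_elt $1$1 = 0" "weyl_elt $1$2 = 1" "weyl_elt $2$1 = - 1"
  "weyl_elt $2$2 = 0"
  by (simp_all add: weyl_elt_def)

lemma g_mat_nth [simp]: "g_mat b c $1$1 = 1" "g_mat b c $1$2 = b" "g_mat b c $2$1 = c"
  "g_mat b c $2$2 = 1 + b * c"
  by (simp_all add: g_mat_def)

lemma diag_elt_Sp [intro, simp]: "a \<noteq> 0 \<Longrightarrow> diag_elt a \<in> Sp"
  and weyl_elt_Sp [intro, simp]: "weyl_elt \<in> Sp"
  and g_mat_Sp [intro, simp]: "g_mat b c \<in> Sp"
  by (simp_all add: Sp_def det_2 algebra_simps)

lemma diag_torus_eq: "diag_torus = diag_elt ` (UNIV - {0})"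
  by (auto simp: diag_torus_def diag_elt_def)

lemma diag_elt_mult: "diag_elt (a * b) = diag_elt a ** diag_elt b"
  by (simp add: mat2_eq_iff mat2_mult_nth)

text \<open>Bruhat decomposition of the big cell. A matrix of determinant 1 with rows (p, q) and (r,
  s), q nonzero, is lower(s/q) diag(q, 1/q) w lower(p/q); here p = 1, q = b and s = 1 + b c.\<close>

lemma g_mat_factor:
  assumes "b \<noteq> 0"
  shows "g_mat b c = g_mat 0 ((1 + b * c) / b) ** diag_elt b ** weyl_elt ** g_mat 0 (inverse b)"
proof -
  have "b * (b * (inverse b * inverse b)) = 1" "b * (c * inverse b) = c"
    using assms by (simp_all flip: divide_inverse mult.assoc)
  thus ?thesis
    using assms by (simp add: mat2_eq_iff mat2_mult_nth divide_inverse algebra_simps)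
qed

text \<open>Once the right side is factored by \<open>g_mat_factor\<close>, this relation contains a
  torus element besides unipotents and \<open>weyl_elt\<close>; it is the source of the Gauss sum
  identity that fixes the torus scalar.\<close>

lemma weyl_mult_lower: "weyl_elt ** g_mat 0 (- b) = g_mat b 0 ** weyl_elt"
  by (simp add: mat2_eq_iff mat2_mult_nth)

lemma heis_rep_nth: "heis_rep (\<tau>, w, z) f $ t = psi (1/2 * \<tau> * w + z + w * t) * f $ (t + \<tau>)"
  by (simp add: modulation_op_def shift_op_def psi_add)

lemma heis_act_eq:
  "heis_act g (\<tau>, w, z) = (g$1$1 * \<tau> + g$1$2 * w, g$2$1 * \<tau> + g$2$2 * w, z)"
  by (simp add: Let_def matrix_vector_mult_def sum_2)

declare heis_act.simps [simp del] heis_rep.simps [simp del] split_paired_All [simp del]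

lemma heis_act_mult: "heis_act (g ** h) x = heis_act g (heis_act h x)"
  by (cases x) (simp add: heis_act_eq mat2_mult_nth algebra_simps)

text \<open>The defining relation of the Weil representation in a form without inverses, so that
  concrete operators satisfy it by direct computation and composites inherit it.\<close>

definition intertwines :: "'p::prime_card mat2 \<Rightarrow> ('p hilb \<Rightarrow> 'p hilb) \<Rightarrow> bool" where
  "intertwines g V \<longleftrightarrow> Vector_Spaces.linear (*s) (*s) V \<and>
     (\<forall>h f. V (heis_rep h f) = heis_rep (heis_act g h) (V f))"

lemma hilb_linear_iff: "Vector_Spaces.linear (*s) (*s) V \<longleftrightarrow>
    (\<forall>f g. V (f + g) = V f + V g) \<and> (\<forall>c f. V (c *s f) = c *s V f)"
  for V :: "'p::prime_card hilb \<Rightarrow> 'p hilb"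
  by (simp add: Vector_Spaces.linear_iff vec.vector_space_axioms)

lemma intertwinesI:
  assumes "\<And>f g. V (f + g) = V f + V g" and "\<And>c f. V (c *s f) = c *s V f"
    and "\<And>\<tau> w z f t. V (heis_rep (\<tau>, w, z) f) $ t = heis_rep (heis_act g (\<tau>, w, z)) (V f) $ t"
  shows "intertwines g V"
proof -
  have "V (heis_rep h f) = heis_rep (heis_act g h) (V f)" for h f
    by (cases h) (simp add: vec_eq_iff assms(3))
  thus ?thesis using assms(1,2) by (simp add: intertwines_def hilb_linear_iff)
qed

lemma intertwines_comp: "intertwines g U \<Longrightarrow> intertwines h V \<Longrightarrow> intertwines (g ** h) (U \<circ> V)"
  by (simp add: intertwines_def hilb_linear_iff heis_act_mult)

lemma intertwines_M_op:
  assumes "odd CARD('p::prime_card)"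
  shows "intertwines (g_mat 0 (c :: 'p mod_ring)) (M_op c)"
proof (rule intertwinesI)
  fix \<tau> w z t :: "'p mod_ring" and f
  \<comment> \<open>With the half as an atom and \<open>c = c' + c'\<close>, completing the square
    is a polynomial identity: shifting the quadratic phase by \<tau> produces the linear term
    \<open>c * \<tau> * t\<close>, and the constant is absorbed by the half in
    \<open>heis_rep\<close>.\<close>
  define c' where "c' = c / 2"
  have c: "c = c' + c'" "c / 2 = c'"
    using two_nonzero[OF assms] by (simp_all add: c'_def flip: mult_2)
  have "1/2 * \<tau> * (c * \<tau> + w) = c / 2 * \<tau>^2 + 1/2 * \<tau> * w"
    by (simp add: power2_eq_square distrib_left mult_ac)
  hence "- (c / 2) * t^2 + (1/2 * \<tau> * w + z + w * t) =
      1/2 * \<tau> * (c * \<tau> + w) + z + (c * \<tau> + w) * t + - (c / 2) * (t + \<tau>)^2"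
    unfolding c(2) by (simp add: c(1) power2_eq_square algebra_simps two_nonzero[OF assms])
  hence "psi (- (c / 2) * t^2) * psi (1/2 * \<tau> * w + z + w * t) =
      psi (1/2 * \<tau> * (c * \<tau> + w) + z + (c * \<tau> + w) * t) * psi (- (c / 2) * (t + \<tau>)^2)"
    by (simp only: psi_add[symmetric])
  thus "M_op c (heis_rep (\<tau>, w, z) f) $ t =
      heis_rep (heis_act (g_mat 0 c) (\<tau>, w, z)) (M_op c f) $ t"
    by (simp add: M_op_def heis_rep_nth heis_act_eq mult.assoc[symmetric])
qed (auto simp: M_op_def vec_eq_iff algebra_simps)

lemma intertwines_S_op:
  assumes "a \<noteq> 0"
  shows "intertwines (diag_elt a) (S_op a)"
proof (rule intertwinesI)
  fix \<tau> w z t :: "'a mod_ring" and f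
  have "inverse a * (t + a * \<tau>) = inverse a * t + \<tau>"
    using assms by (simp add: distrib_left flip: mult.assoc)
  thus "S_op a (heis_rep (\<tau>, w, z) f) $ t =
      heis_rep (heis_act (diag_elt a) (\<tau>, w, z)) (S_op a f) $ t"
    using assms by (simp add: S_op_def heis_rep_nth heis_act_eq mult_ac)
qed (auto simp: S_op_def vec_eq_iff algebra_simps)

text \<open>Translating the summation variable turns the shift into a modulation and leaves -w
  \<tau> in the exponent. This is twice the half term of \<open>heis_rep\<close>, so it reverses its
  sign, as the map (\<tau>, w) to (w, -\<tau>) requires.\<close>

lemma intertwines_F_op:
  assumes "odd CARD('p::prime_card)"
  shows "intertwines (weyl_elt :: 'p mat2) F_op"
proof (rule intertwinesI)
  fix \<tau> w z x :: "'p mod_ring" and f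
  have "w * \<tau> = 1/2 * \<tau> * w + 1/2 * \<tau> * w"
    using two_nonzero[OF assms] by (simp add: mult.assoc[symmetric] flip: mult_2)
  hence arg: "x * (t - \<tau>) + (1/2 * \<tau> * w + z + w * (t - \<tau>)) =
      1/2 * w * (- \<tau>) + z + - \<tau> * x + (x + w) * t" for t
    by (simp add: algebra_simps)
  have "(\<Sum>t\<in>UNIV. psi (x * t) * (psi (1/2 * \<tau> * w + z + w * t) * f $ (t + \<tau>))) =
      (\<Sum>t\<in>UNIV. psi (x * (t - \<tau>)) * (psi (1/2 * \<tau> * w + z + w * (t - \<tau>)) * f $ t))"
    by (rule sum.reindex_bij_witness[of _ "\<lambda>t. t - \<tau>" "\<lambda>t. t + \<tau>"]) auto
  also have "\<dots> = psi (1/2 * w * (- \<tau>) + z + - \<tau> * x) * (\<Sum>t\<in>UNIV. psi ((x + w) * t) * f $ t)"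
    unfolding mult.assoc[symmetric] sum_distrib_left
    by (simp only: psi_add[symmetric] arg[unfolded mult.assoc[symmetric]] mult.assoc[symmetric])
  finally show "F_op (heis_rep (\<tau>, w, z) f) $ x =
      heis_rep (heis_act weyl_elt (\<tau>, w, z)) (F_op f) $ x"
    by (simp add: F_op_def heis_rep_nth heis_act_eq mult_ac)
qed (auto simp: F_op_def vec_eq_iff algebra_simps sum.distrib sum_distrib_left)

text \<open>Point masses are eigenvectors of the modulation by 1 with distinct eigenvalues
  \<open>psi s\<close>, so a commuting operator is diagonal; shifts carry the point mass at 0 to
  every other one, so its diagonal is constant.\<close>

lemma heis_commutant_scalar:
  fixes W :: "'p::prime_card hilb \<Rightarrow> 'p hilb"
  assumes lin: "Vector_Spaces.linear (*s) (*s) W"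
    and comm: "\<And>h f. W (heis_rep h f) = heis_rep h (W f)"
  obtains z where "\<And>f. W f = z *s f"
proof -
  let ?d = "\<lambda>s :: 'p mod_ring. axis s (1::complex)"
  have sc: "W (c *s f) = c *s W f" for c f
    using lin by (simp add: hilb_linear_iff)
  have off: "W (?d s) $ t = 0" if "s \<noteq> t" for s t
  proof -
    have "heis_rep (0, 1, 0) (?d s) = psi s *s ?d s"
      by (simp add: vec_eq_iff heis_rep_nth axis_def)
    hence "W (psi s *s ?d s) $ t = heis_rep (0, 1, 0) (W (?d s)) $ t"
      by (metis comm)
    hence "psi s * W (?d s) $ t = psi t * W (?d s) $ t"
      by (simp add: sc heis_rep_nth)
    moreover have "psi s \<noteq> psi t"
      using that psi_eq_1_iff[of "s - t"] psi_add[of "s - t" t] by auto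
    ultimately show ?thesis by simp
  qed
  have diag: "W (?d s) $ s = W (?d 0) $ 0" for s
  proof -
    have "heis_rep (- s, 0, 0) (?d 0) = ?d s"
      by (simp add: vec_eq_iff heis_rep_nth axis_def)
    hence "W (?d s) = heis_rep (- s, 0, 0) (W (?d 0))"
      using comm by metis
    thus ?thesis by (simp add: heis_rep_nth)
  qed
  have "W f $ t = W (?d 0) $ 0 * f $ t" for f t
  proof -
    have "W f $ t = (\<Sum>s\<in>UNIV. W (?d s) $ t * f $ s)"
      by (subst matrix_works[OF lin, symmetric]) (simp add: matrix_vector_mult_def matrix_def)
    also have "\<dots> = (\<Sum>s\<in>UNIV. if s = t then W (?d 0) $ 0 * f $ t else 0)"
      using off diag[of t] by (intro sum.cong) auto
    finally show ?thesis by simp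
  qed
  hence "W f = W (?d 0) $ 0 *s f" for f
    unfolding vec_eq_iff vector_smult_component by blast
  thus ?thesis by (rule that)
qed

lemma weil_rep_intertwines:
  assumes "weil_representation \<rho>" and "g \<in> Sp"
  shows "intertwines g (\<rho> g)" and "bij (\<rho> g)" and "herm (\<rho> g f) (\<rho> g f') = herm f f'"
proof -
  have u: "unitary_op (\<rho> g)" and
    c: "\<rho> g \<circ> heis_rep h \<circ> inv_into UNIV (\<rho> g) = heis_rep (heis_act g h)" for h
    using assms by (auto simp: weil_representation_def)
  show bij: "bij (\<rho> g)" and "herm (\<rho> g f) (\<rho> g f') = herm f f'" using u by (auto simp: unitary_op_def)
  have "\<rho> g (heis_rep h f) = heis_rep (heis_act g h) (\<rho> g f)" for h f
    using fun_cong[OF c, of h "\<rho> g f"] bij by (simp add: bij_is_inj)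
  thus "intertwines g (\<rho> g)" using u by (auto simp: intertwines_def unitary_op_def)
qed

text \<open>The operator \<rho>(g)^{-1} V commutes with the Heisenberg group. The scalar stands on
  the side of \<rho>(g) because V may still be zero.\<close>

lemma intertwiner_unique:
  assumes \<rho>: "weil_representation \<rho>" "g \<in> Sp" and V: "intertwines g V"
  obtains z where "\<And>f. V f = z *s \<rho> g f"
proof -
  note w = weil_rep_intertwines[OF \<rho>]
  define W where "W = inv_into UNIV (\<rho> g) \<circ> V"
  have rW: "\<rho> g (W f) = V f" for f
    unfolding W_def using w(2) by (simp add: bij_is_surj surj_f_inv_f)
  have inj: "x = y" if "\<rho> g x = \<rho> g y" for x y
    using that w(2) by (auto simp: bij_def inj_on_def)
  have "W (f + f') = W f + W f'" "W (c *s f) = c *s W f" for c f f'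
    by (rule inj, use V w(1) in \<open>simp add: rW intertwines_def hilb_linear_iff\<close>)+
  hence "Vector_Spaces.linear (*s) (*s) W"
    by (simp add: hilb_linear_iff)
  moreover have "W (heis_rep h f) = heis_rep h (W f)" for h f
    by (rule inj) (use V w(1) in \<open>simp add: rW intertwines_def\<close>)
  ultimately obtain z where "\<And>f. W f = z *s f" using heis_commutant_scalar[of W] by metis
  hence "V f = z *s \<rho> g f" for f
    using rW[of f] w(1) by (simp add: intertwines_def hilb_linear_iff)
  thus ?thesis by (rule that)
qed

lemma herm_scale: "herm (z *s f) (z *s f) = of_real ((cmod z)^2) * herm f f"
  by (simp add: herm_def sum_distrib_left complex_norm_square mult_ac del: of_real_power)

text \<open>Since V is already a multiple of a unitary operator, preserving the norm of one vector
  of nonzero norm fixes the modulus of the scalar. This saves proving each concrete operator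
  unitary; the test vector below is the point mass at 0.\<close>

lemma intertwiner_unitary_scalar:
  assumes \<rho>: "weil_representation \<rho>" "g \<in> Sp" and V: "intertwines g V"
    and f0: "herm (V f0) (V f0) = herm f0 f0" "herm f0 f0 \<noteq> 0"
  shows "eq_up_to_unitary_scalar (\<rho> g) V"
proof -
  obtain z where z: "\<And>f. V f = z *s \<rho> g f" using intertwiner_unique[OF \<rho> V] by blast
  have "of_real ((cmod z)^2) * herm f0 f0 = herm f0 f0"
    using f0(1) unfolding z herm_scale weil_rep_intertwines[OF \<rho>] .
  hence "complex_of_real ((cmod z)^2) = 1" using f0(2) by simp
  hence "(cmod z)^2 = 1" using of_real_eq_1_iff by blast
  hence 1: "cmod z = 1" by (simp add: power2_eq_1_iff) (metis norm_ge_zero neg_0_le_iff_le not_one_le_zero)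
  hence "z \<noteq> 0" by auto
  hence "\<rho> g = (\<lambda>f. inverse z *s V f)" by (simp add: z fun_eq_iff vector_smult_assoc)
  moreover have "cmod (inverse z) = 1" using 1 by (simp add: norm_inverse)
  ultimately show ?thesis unfolding eq_up_to_unitary_scalar_def by blast
qed

lemma M_op_axis_0: "M_op c (axis 0 z) = axis 0 z"
  by (simp add: M_op_def vec_eq_iff axis_def)

lemma F_op_axis_0: "F_op (axis 0 1) = (\<chi> t. of_real (1 / sqrt (real CARD('p::prime_card))) :: complex^('p mod_ring))"
  by (simp add: F_op_def vec_eq_iff axis_def if_distrib cong: if_cong)

lemma herm_axis: "herm (axis s 1) (axis s 1) = 1"
  by (simp add: herm_def axis_def if_distrib cong: if_cong)

lemma weil_rep_lower:
  assumes "odd CARD('p::prime_card)" "weil_representation \<rho>"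
  shows "eq_up_to_unitary_scalar (\<rho> (g_mat 0 (c :: 'p mod_ring))) (M_op c)"
  by (rule intertwiner_unitary_scalar[where ?f0.0 = "axis 0 1"])
     (use assms in \<open>auto simp: M_op_axis_0 herm_axis intertwines_M_op\<close>)

lemma weil_rep_g_mat:
  assumes odd: "odd CARD('p::prime_card)" and \<rho>: "weil_representation \<rho>" and b: "(b :: 'p mod_ring) \<noteq> 0"
  shows "eq_up_to_unitary_scalar (\<rho> (g_mat b c))
     (M_op ((1 + b * c) / b) \<circ> S_op b \<circ> F_op \<circ> M_op (inverse b))"
proof (rule intertwiner_unitary_scalar[where ?f0.0 = "axis 0 1"])
  show "intertwines (g_mat b c) (M_op ((1 + b * c) / b) \<circ> S_op b \<circ> F_op \<circ> M_op (inverse b))"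
    unfolding g_mat_factor[OF b]
    by (intro intertwines_comp intertwines_M_op intertwines_S_op intertwines_F_op odd b)
  let ?V = "M_op ((1 + b * c) / b) \<circ> S_op b \<circ> F_op \<circ> M_op (inverse b)"
  let ?d = "axis 0 1 :: 'p hilb"
  have n: "z * cnj z = of_real ((cmod z)^2)" for z by (simp only: complex_norm_square)
  \<comment> \<open>The inner \<open>M_op\<close> fixes the point mass at 0, \<open>F_op\<close>
    spreads it to the constant 1 / sqrt p, and the outer factors change no modulus.\<close>
  have "cmod (?V ?d $ t) = 1 / sqrt (real CARD('p))" for t
    using b by (simp add: M_op_axis_0 F_op_axis_0 sigma0_eq) (simp add: M_op_def S_op_def norm_mult norm_divide sigma0_eq)
  hence "herm (?V ?d) (?V ?d) = 1"
    unfolding herm_def n by (simp add: power_divide)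
  thus "herm (?V ?d) (?V ?d) = herm ?d ?d" by (simp only: herm_axis)
qed (use \<rho> in \<open>auto simp: herm_axis\<close>)

subsection \<open>The Weil representation on the diagonal torus\<close>

lemma weil_rep_mult:
  assumes "weil_representation \<rho>" "g \<in> Sp" "h \<in> Sp"
  shows "\<rho> (g ** h) f = \<rho> g (\<rho> h f)"
  using assms by (auto simp: weil_representation_def)

lemma weil_rep_scale:
  assumes "weil_representation \<rho>" "g \<in> Sp"
  shows "\<rho> g (z *s f) = z *s \<rho> g f"
  using weil_rep_intertwines(1)[OF assms] by (simp add: intertwines_def hilb_linear_iff)

lemma weil_rep_inject:
  assumes "weil_representation \<rho>" "g \<in> Sp"
  shows "\<rho> g f = \<rho> g f' \<longleftrightarrow> f = f'"
  using weil_rep_intertwines(2)[OF assms] by (auto simp: bij_def inj_on_def)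

lemma weil_rep_mat_1:
  assumes "weil_representation \<rho>"
  shows "\<rho> (mat 1) f = f"
  using weil_rep_mult[OF assms, of "mat 1" "mat 1" f] weil_rep_inject[OF assms, of "mat 1"] by simp

lemma S_op_axis_0: "a \<noteq> 0 \<Longrightarrow> S_op a (axis 0 1) = sigma0 a *s axis 0 1"
  by (simp add: S_op_def vec_eq_iff axis_def)

lemma F_op_const: "F_op (\<chi> t. 1) = of_real (sqrt (real CARD('p::prime_card))) *s (axis 0 1 :: 'p hilb)"
proof -
  have "complex_of_real (1 / sqrt (real CARD('p))) * of_nat CARD('p) = of_real (sqrt (real CARD('p)))"
    by (metis of_real_mult of_real_of_nat_eq real_div_sqrt of_nat_0_le_iff times_divide_eq_left mult_1)
  moreover have "(\<Sum>t\<in>UNIV. psi (w * t :: 'p mod_ring)) = of_nat CARD('p) * (if w = 0 then 1 else 0)" for w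
    by (simp add: sum_psi)
  ultimately show ?thesis by (simp add: F_op_def vec_eq_iff axis_def)
qed

lemma sigma0_nonzero: "a \<noteq> 0 \<Longrightarrow> sigma0 a \<noteq> 0"
  by (simp add: sigma0_eq)

lemma weil_rep_diag_scalar:
  assumes \<rho>: "weil_representation \<rho>" and "a \<noteq> 0"
  shows "\<exists>l. \<rho> (diag_elt a) = (\<lambda>f. l *s S_op a f)"
proof -
  have "eq_up_to_unitary_scalar (\<rho> (diag_elt a)) (S_op a)"
    by (rule intertwiner_unitary_scalar[where ?f0.0 = "axis 0 1"])
       (use assms in \<open>auto simp: S_op_axis_0 herm_scale herm_axis intertwines_S_op sigma0_eq\<close>)
  thus ?thesis unfolding eq_up_to_unitary_scalar_def by blast
qed

text \<open>Removes the unknown scalars of the unipotents from the Gauss sum comparison. They are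
  read off on the point mass at 0, a common eigenvector of the lower unipotents and the diagonal
  torus.\<close>

lemma weil_rep_lower_exact:
  assumes odd: "odd CARD('p::prime_card)" and \<rho>: "weil_representation \<rho>" and "CARD('p) \<noteq> 3"
  shows "\<rho> (g_mat 0 (t :: 'p mod_ring)) = M_op t"
proof -
  let ?e = "axis 0 1 :: 'p hilb"
  have three: "(3 :: 'p mod_ring) \<noteq> 0"
  proof
    assume "(3 :: 'p mod_ring) = 0"
    hence "CARD('p) dvd 3" using of_nat_0_mod_ring_dvd[of 3, where 'a='p] by simp
    moreover have "prime (3::nat)" by simp
    ultimately show False using assms(3) prime_card[where 'a='p] primes_dvd_imp_eq by blast
  qed
  have "\<exists>\<mu>. \<forall>t. \<rho> (g_mat 0 (t :: 'p mod_ring)) = (\<lambda>f. \<mu> t *s M_op t f)"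
    using weil_rep_lower[OF odd \<rho>] unfolding eq_up_to_unitary_scalar_def by metis
  then obtain \<mu> where \<mu>: "\<And>t f. \<rho> (g_mat 0 (t :: 'p mod_ring)) f = \<mu> t *s M_op t f"
    by metis
  have e: "\<rho> (g_mat 0 t) ?e = \<mu> t *s ?e" for t
    by (simp add: \<mu> M_op_axis_0)
  have e1: "z *s ?e = z' *s ?e \<longleftrightarrow> z = z'" for z z'
    by (auto simp: vec_eq_iff axis_def)
  have add: "\<mu> (s + t) = \<mu> s * \<mu> t" for s t
  proof -
    have "g_mat 0 (s + t) = g_mat 0 s ** g_mat 0 t" by (simp add: mat2_eq_iff mat2_mult_nth)
    hence "\<rho> (g_mat 0 (s + t)) ?e = \<rho> (g_mat 0 s) (\<rho> (g_mat 0 t) ?e)"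
      by (simp add: weil_rep_mult[OF \<rho>])
    thus ?thesis by (simp add: e weil_rep_scale[OF \<rho>] vector_smult_assoc e1)
  qed
  have nz: "\<mu> s \<noteq> 0" for s
  proof
    assume "\<mu> s = 0"
    hence "\<rho> (g_mat 0 s) ?e = \<rho> (g_mat 0 s) 0"
      using e[of s] weil_rep_scale[OF \<rho>, of "g_mat 0 s" 0 0] by simp
    hence "?e = 0" by (simp only: weil_rep_inject[OF \<rho>] g_mat_Sp)
    hence "?e $ 0 = 0" by simp
    thus False by (simp add: axis_def)
  qed
  \<comment> \<open>Conjugation by diag(2,1/2) multiplies t by 4, so the additive character \<open>\<mu>\<close> is trivial on multiples of 3.\<close>
  have four: "\<mu> (2 * 2 * s) = \<mu> s" for s
  proof -
    let ?d = "diag_elt 2 :: 'p mat2"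
    have two: "(2 :: 'p mod_ring) \<noteq> 0" by (rule two_nonzero[OF odd])
    obtain l where l: "\<rho> ?d = (\<lambda>f. l *s S_op 2 f)"
      using weil_rep_diag_scalar[OF \<rho> two] by blast
    have "2 * (inverse 2 * (2 * s)) = 2 * s"
      using two by (simp flip: mult.assoc)
    hence "?d ** g_mat 0 (2 * 2 * s) = g_mat 0 s ** ?d"
      using two by (simp add: mat2_eq_iff mat2_mult_nth mult_ac)
    hence "\<rho> ?d (\<rho> (g_mat 0 (2 * 2 * s)) ?e) = \<rho> (g_mat 0 s) (\<rho> ?d ?e)"
      using two by (metis weil_rep_mult[OF \<rho>] diag_elt_Sp g_mat_Sp)
    moreover have "\<rho> ?d ?e = (l * sigma0 (2 :: 'p mod_ring)) *s ?e"
      using two by (simp add: l S_op_axis_0 vector_smult_assoc)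
    ultimately have "\<mu> (2 * 2 * s) *s \<rho> ?d ?e = \<mu> s *s \<rho> ?d ?e"
      using two by (simp add: e weil_rep_scale[OF \<rho>] vector_smult_assoc mult.commute)
    hence "\<rho> ?d (\<mu> (2 * 2 * s) *s ?e) = \<rho> ?d (\<mu> s *s ?e)"
      using two by (simp add: weil_rep_scale[OF \<rho>])
    thus ?thesis unfolding weil_rep_inject[OF \<rho> diag_elt_Sp[OF two]] e1 .
  qed
  have "\<mu> (3 * s) = 1" for s
  proof -
    have "3 * s + s = 2 * 2 * s" by (simp add: algebra_simps)
    hence "\<mu> (3 * s) * \<mu> s = \<mu> s" using add[of "3 * s" s] four[of s] by simp
    thus ?thesis using nz by simp
  qed
  from this[of "t / 3"] have "\<mu> t = 1" using three by simp
  thus ?thesis by (simp add: \<mu> fun_eq_iff)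
qed

text \<open>At g = -1 the matrix \<open>kappa g\<close> vanishes, so with v = 0 the prescribed trace
  is \<open>sigma0 (- 1)\<close>. The reflection t to -t fixes only 0, so the trace of
  \<open>l *s S_op (- 1)\<close> is a single diagonal entry.\<close>

lemma weil_rep_minus_1:
  assumes odd: "odd CARD('p::prime_card)" and \<rho>: "weil_representation (\<rho> :: 'p mat2 \<Rightarrow> _)"
    and p3: "CARD('p) = 3"
  shows "\<rho> (diag_elt (- 1)) = S_op (- 1)"
proof -
  let ?g = "diag_elt (- 1) :: 'p mat2"
  have two: "(2 :: 'p mod_ring) \<noteq> 0" by (rule two_nonzero[OF odd])
  obtain l where l: "\<rho> ?g = (\<lambda>f. l *s S_op (- 1) f)"
    using weil_rep_diag_scalar[OF \<rho>, of "- 1"] by auto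
  have inv: "inverse (- 1) = (- 1 :: 'p mod_ring)" by (rule inverse_unique) simp
  have g: "?g + mat 1 = 0"
    by (simp add: mat2_eq_iff inv)
  hence det: "det (kappa ?g + mat 1) = 1" by (simp add: kappa_def)
  have "det (?g - mat 1) = 2 * 2"
    by (simp add: det_2 inv)
  hence "invertible (?g - mat 1)"
    using two by (metis invertible_det_nz mult_eq_0_iff)
  moreover have tr: "op_trace (\<rho> h \<circ> heis_rep (- v $ 1, - v $ 2, 0)) =
      sigma0 (- det (kappa h + mat 1)) * psi (1/4 * omega (kappa h *v v) v)"
    if "h \<in> Sp" "invertible (h - mat 1)" for h and v :: "'p plane"
    using \<rho> p3 that unfolding weil_representation_def by blast
  ultimately have "op_trace (\<rho> ?g \<circ> heis_rep (- (0 :: 'p plane) $ 1, - (0 :: 'p plane) $ 2, 0)) =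
      sigma0 (- det (kappa ?g + mat 1)) * psi (1/4 * omega (kappa ?g *v (0 :: 'p plane)) 0)"
    by (intro tr) simp_all
  hence "op_trace (\<rho> ?g \<circ> heis_rep (0, 0, 0)) = sigma0 (- 1 :: 'p mod_ring)"
    by (simp add: det omega_def)
  moreover have "heis_rep (0, 0, 0) f = f" for f :: "'p hilb"
    by (simp add: vec_eq_iff heis_rep_nth)
  hence "op_trace (\<rho> ?g \<circ> heis_rep (0, 0, 0)) = (\<Sum>t\<in>UNIV. l * (sigma0 (- 1 :: 'p mod_ring) * axis (t :: 'p mod_ring) 1 $ (- t)))"
    by (simp add: op_trace_def trace_def matrix_def l S_op_def inv)
  moreover have "axis t 1 $ (- t) = (if t = 0 then 1 else 0 :: complex)" for t :: "'p mod_ring"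
  proof -
    have "- t = t \<longleftrightarrow> t = 0"
    proof
      assume "- t = t"
      hence "2 * t = 0" by (metis add.right_inverse mult_2)
      thus "t = 0" using two by simp
    qed simp
    thus ?thesis by (auto simp: axis_def)
  qed
  ultimately have "l * sigma0 (- 1 :: 'p mod_ring) = sigma0 (- 1 :: 'p mod_ring)"
    by (simp add: sum_distrib_left if_distrib cong: if_cong)
  hence "l = 1" using sigma0_nonzero[of "- 1 :: 'p mod_ring"] by simp
  thus ?thesis by (simp add: l)
qed

lemma diag_elt_1: "diag_elt 1 = mat 1"
  by (simp add: mat2_eq_iff)

lemma S_op_1: "S_op 1 f = f"
proof -
  have "sigma0 (1 :: 'a mod_ring) = 1" by (simp add: sigma0_eq) (metis one_power2)
  thus ?thesis by (simp add: S_op_def vec_eq_iff)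
qed

text \<open>The sign \<open>sigma0 a\<close> in \<open>S_op a\<close> is the sign by which the Gauss
  sum of a t^2 / 2 differs from that of t^2 / 2. After cancelling it, the remaining scalar is the
  same for all \<open>a\<close>.\<close>

lemma weil_rep_diag:
  assumes odd: "odd CARD('p::prime_card)" and \<rho>: "weil_representation \<rho>" and a: "(a :: 'p mod_ring) \<noteq> 0"
  shows "\<rho> (diag_elt a) = S_op a"
proof (cases "CARD('p) = 3")
  case True
  obtain i where "i < 3" "a = of_nat i" using surj_of_nat_mod_ring[of a] True by auto
  \<comment> \<open>In F_3 the only units are 1 and 2 = -1.\<close>
  moreover have "(2 :: 'p mod_ring) + 1 = 0" using of_nat_card_eq_0[where 'a='p] True by simp
  hence "(2 :: 'p mod_ring) = - 1" by (simp only: eq_neg_iff_add_eq_0)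
  ultimately have "a = 1 \<or> a = - 1"
    using a by (auto simp: less_Suc_eq numeral_3_eq_3)
  thus ?thesis
    using weil_rep_minus_1[OF odd \<rho> True] by (auto simp: diag_elt_1 weil_rep_mat_1[OF \<rho>] S_op_1)
next
  case False
  let ?e = "axis 0 1 :: 'p hilb" and ?one = "(\<chi> t. 1) :: 'p hilb"
  let ?q = "complex_of_real (sqrt (real CARD('p)))"
  have q: "?q \<noteq> 0" by simp
  have "eq_up_to_unitary_scalar (\<rho> weyl_elt) F_op"
  proof (rule intertwiner_unitary_scalar[where ?f0.0 = ?e])
    have "herm (F_op ?e) (F_op ?e) = of_nat CARD('p) * of_real ((1 / sqrt (real CARD('p)))^2)"
      by (simp add: F_op_axis_0 herm_def power2_eq_square del: real_sqrt_mult_self)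
    also have "\<dots> = 1" by (simp add: power_divide)
    finally show "herm (F_op ?e) (F_op ?e) = herm ?e ?e" by (simp add: herm_axis)
  qed (use \<rho> in \<open>auto simp: herm_axis intertwines_F_op[OF odd]\<close>)
  then obtain c where "cmod c = 1" and w: "\<rho> weyl_elt = (\<lambda>f. c *s F_op f)"
    unfolding eq_up_to_unitary_scalar_def by blast
  hence c: "c \<noteq> 0" by auto
  have low: "\<rho> (g_mat 0 t) = M_op t" for t :: "'p mod_ring"
    by (rule weil_rep_lower_exact[OF odd \<rho> False])
  let ?G = "\<Sum>t\<in>UNIV. psi (1/2 * t^2 :: 'p mod_ring)"
  \<comment> \<open>Both sides of \<open>weyl_mult_lower\<close> applied to the constant function, evaluated at 0.\<close>
  have key: "l * c * ?q = ?G" if b: "b \<noteq> 0" and l: "\<rho> (diag_elt b) = (\<lambda>f. l *s S_op b f)" for b l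
  proof -
    \<comment> \<open>The outer \<open>M_op\<close> is invisible at 0. The constant function is
      taken because \<open>F_op\<close> sends it to a point mass, which the inner
      \<open>M_op\<close> fixes, while the other side becomes a pure Gauss sum.\<close>
    have M: "M_op t f $ 0 = f $ 0" for t f by (simp add: M_op_def)
    have "\<rho> weyl_elt (\<rho> (g_mat 0 (- b)) ?one) = \<rho> (g_mat b 0) (\<rho> weyl_elt ?one)"
      using weyl_mult_lower[of b] by (metis weil_rep_mult[OF \<rho>] weyl_elt_Sp g_mat_Sp)
    also have "\<rho> (g_mat b 0) f = M_op (1 / b) (\<rho> (diag_elt b) (\<rho> weyl_elt (M_op (inverse b) f)))" for f
      unfolding g_mat_factor[OF b, of 0] using b
      by (simp add: weil_rep_mult[OF \<rho>] Sp_mult low)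
    finally have "\<rho> weyl_elt (\<rho> (g_mat 0 (- b)) ?one) $ 0 = \<rho> (diag_elt b) (\<rho> weyl_elt (M_op (inverse b) (\<rho> weyl_elt ?one))) $ 0"
      by (simp only: M)
    also have "\<rho> weyl_elt (M_op (inverse b) (\<rho> weyl_elt ?one)) = (c * c * ?q) *s F_op ?e"
    proof -
      have "M_op t (z *s ?e) = z *s ?e" for t z by (simp add: M_op_def vec_eq_iff axis_def)
      hence "M_op (inverse b) (\<rho> weyl_elt ?one) = (c * ?q) *s ?e"
        by (simp add: w F_op_const vector_smult_assoc)
      thus ?thesis
        by (simp add: weil_rep_scale[OF \<rho>]) (simp add: w vector_smult_assoc mult_ac)
    qed
    also have "\<rho> (diag_elt b) \<dots> $ 0 = c * c * l * sigma0 b"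
      using q by (simp add: l F_op_axis_0 S_op_def)
    also have "\<rho> weyl_elt (\<rho> (g_mat 0 (- b)) ?one) $ 0 = c * (\<Sum>t\<in>UNIV. psi (1/2 * (b * t^2))) / ?q"
      by (simp add: w low F_op_def M_op_def)
    also have "(\<Sum>t\<in>UNIV. psi (1/2 * (b * t^2))) = sigma0 b * ?G"
      using two_nonzero[OF odd] by (intro gauss_sum_mult odd b) simp
    finally show ?thesis using c q sigma0_nonzero[OF b] by (simp add: field_simps)
  qed
  obtain l where l: "\<rho> (diag_elt a) = (\<lambda>f. l *s S_op a f)"
    using weil_rep_diag_scalar[OF \<rho> a] by blast
  have "\<rho> (diag_elt 1) = (\<lambda>f. 1 *s S_op 1 f)"
    by (simp add: diag_elt_1 weil_rep_mat_1[OF \<rho>] S_op_1 fun_eq_iff)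
  \<comment> \<open>The right side of \<open>key\<close> does not involve b, so l agrees with its
    value 1 at b = 1.\<close>
  hence "l * c * ?q = 1 * c * ?q" using key[OF a l] key[of 1 1] by simp
  hence "l = 1" using c q by simp
  thus ?thesis by (simp add: l)
qed

subsection \<open>Split tori and their characters\<close>

lemma matrix_inv_inverse:
  fixes g :: "'p::prime_card mat2"
  assumes "g \<in> Sp"
  shows "g ** matrix_inv g = mat 1" and "matrix_inv g ** g = mat 1"
proof -
  have "invertible g" using assms by (simp add: Sp_def invertible_det_nz)
  hence "g ** matrix_inv g = mat 1 \<and> matrix_inv g ** g = mat 1"
    unfolding invertible_def matrix_inv_def by (rule someI_ex)
  thus "g ** matrix_inv g = mat 1" "matrix_inv g ** g = mat 1" by auto
qed

lemma matrix_inv_Sp: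
  assumes "g \<in> Sp"
  shows "matrix_inv g \<in> Sp"
  using arg_cong[OF matrix_inv_inverse(1)[OF assms], of det] assms by (simp add: Sp_def det_mul)

lemma matrix_inv_mult:
  assumes "g \<in> Sp" "h \<in> Sp"
  shows "matrix_inv (g ** h) = matrix_inv h ** matrix_inv g"
proof -
  have "matrix_inv (g ** h) ** ((g ** h) ** (matrix_inv h ** matrix_inv g)) = matrix_inv h ** matrix_inv g"
    using matrix_inv_inverse(2)[OF Sp_mult[OF assms]] by (simp add: matrix_mul_assoc)
  moreover have "(g ** h) ** (matrix_inv h ** matrix_inv g) = mat 1"
    using matrix_inv_inverse[OF assms(1)] matrix_inv_inverse[OF assms(2)]
    by (metis matrix_mul_assoc matrix_mul_rid)
  ultimately show ?thesis by simp
qed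

lemma conj_set_mult:
  assumes "g \<in> Sp" "h \<in> Sp"
  shows "conj_set (g ** h) T = conj_set g (conj_set h T)"
  by (simp add: conj_set_def matrix_inv_mult[OF assms] image_image matrix_mul_assoc)

lemma conj_eqI:
  assumes "h \<in> Sp" "h ** x = z ** h"
  shows "h ** x ** matrix_inv h = z"
  using assms(2) matrix_inv_inverse(1)[OF assms(1)] by (metis matrix_mul_assoc matrix_mul_rid)

text \<open>A parametrisation of the torus by units. It depends on g and not only on the torus:
  \<open>weyl_elt\<close> yields A again, with the parameter inverted.\<close>

definition conj_elt :: "'p::prime_card mat2 \<Rightarrow> 'p mod_ring \<Rightarrow> 'p mat2" where
  "conj_elt g a = g ** diag_elt a ** matrix_inv g"

lemma conj_diag_torus: "conj_set g diag_torus = conj_elt g ` (UNIV - {0})"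
  by (simp add: conj_set_def diag_torus_eq image_image conj_elt_def)

lemma conj_elt_mult:
  assumes "g \<in> Sp"
  shows "conj_elt g a ** conj_elt g b = conj_elt g (a * b)"
proof -
  have "conj_elt g a ** conj_elt g b = g ** diag_elt a ** (matrix_inv g ** g) ** diag_elt b ** matrix_inv g"
    by (simp add: conj_elt_def matrix_mul_assoc)
  thus ?thesis using matrix_inv_inverse(2)[OF assms]
    by (simp add: conj_elt_def diag_elt_mult matrix_mul_assoc)
qed

lemma conj_elt_mult_left:
  assumes "g \<in> Sp"
  shows "conj_elt g a ** g = g ** diag_elt a"
  using matrix_inv_inverse(2)[OF assms]
  by (metis conj_elt_def matrix_mul_assoc matrix_mul_rid)

lemma conj_elt_Sp: "g \<in> Sp \<Longrightarrow> a \<noteq> 0 \<Longrightarrow> conj_elt g a \<in> Sp"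
  by (simp add: conj_elt_def Sp_mult matrix_inv_Sp)

lemma conj_elt_mat_1: "conj_elt (mat 1) a = diag_elt a"
  unfolding conj_elt_def by (rule conj_eqI) simp_all

lemma conj_set_diag_elt:
  assumes "a \<noteq> 0"
  shows "conj_set (diag_elt a) diag_torus = diag_torus"
proof -
  have "conj_elt (diag_elt a) b = diag_elt b" for b
    unfolding conj_elt_def using assms
    by (intro conj_eqI) (auto simp: mult.commute simp flip: diag_elt_mult)
  thus ?thesis unfolding conj_diag_torus by (simp add: diag_torus_eq)
qed

lemma conj_set_weyl_elt: "conj_set weyl_elt diag_torus = diag_torus"
proof -
  have "conj_elt weyl_elt b = diag_elt (inverse b)" for b :: "'a mod_ring"
    unfolding conj_elt_def
    by (intro conj_eqI) (auto simp: mat2_eq_iff mat2_mult_nth)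
  hence "conj_set weyl_elt diag_torus = diag_elt ` inverse ` (UNIV - {0 :: 'a mod_ring})"
    by (simp add: conj_diag_torus image_image)
  also have "inverse ` (UNIV - {0 :: 'a mod_ring}) = UNIV - {0}"
  proof
    show "UNIV - {0} \<subseteq> inverse ` (UNIV - {0 :: 'a mod_ring})"
    proof
      fix x :: "'a mod_ring" assume "x \<in> UNIV - {0}"
      thus "x \<in> inverse ` (UNIV - {0})" by (intro image_eqI[of x inverse "inverse x"]) simp_all
    qed
  qed auto
  finally show ?thesis by (simp add: diag_torus_eq)
qed

lemma conj_set_g_mat_of_nonzero_corner:
  fixes g :: "'p::prime_card mat2"
  assumes g: "g \<in> Sp" and a: "g$1$1 \<noteq> 0"
  shows "\<exists>b c. conj_set g diag_torus = conj_set (g_mat b c) diag_torus"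
proof -
  \<comment> \<open>Dividing the first column by its top entry and multiplying the second by it
    turns g into \<open>g_mat b c\<close>; this is right division by
    \<open>diag_elt (g$1$1)\<close>, which normalises A.\<close>
  define b where "b = g$1$2 * g$1$1"
  define c where "c = g$2$1 * inverse (g$1$1)"
  have "b * c = g$1$2 * g$2$1 * (g$1$1 * inverse (g$1$1))" by (simp only: b_def c_def mult_ac)
  hence "1 + b * c = g$1$1 * g$2$2"
    using g a by (simp add: Sp_def det_2 algebra_simps)
  hence "g = g_mat b c ** diag_elt (g$1$1)"
    using a by (simp add: mat2_eq_iff mat2_mult_nth) (simp add: b_def c_def)
  hence "conj_set g diag_torus = conj_set (g_mat b c) diag_torus"
    using a by (metis conj_set_mult conj_set_diag_elt diag_elt_Sp g_mat_Sp)
  thus ?thesis by blast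
qed

text \<open>A vanishing corner is repaired by right multiplication with \<open>weyl_elt\<close>: the
  torus stays, and the corner becomes the negative of \<open>g$1$2\<close>, nonzero because the
  determinant is 1.\<close>

lemma split_torus_eq_g_mat:
  fixes T :: "'p::prime_card mat2 set"
  assumes "split_torus T"
  shows "\<exists>b c. T = conj_set (g_mat b c) diag_torus"
proof -
  obtain g where g: "g \<in> Sp" and T: "T = conj_set g diag_torus"
    using assms by (auto simp: split_torus_def)
  show ?thesis
  proof (cases "g$1$1 = 0")
    case False
    thus ?thesis using conj_set_g_mat_of_nonzero_corner[OF g] T by simp
  next
    case True
    let ?h = "g ** weyl_elt"
    have "g$1$2 \<noteq> 0" using g True by (auto simp: Sp_def det_2)
    hence "?h$1$1 \<noteq> 0" by (simp add: mat2_mult_nth)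
    moreover have "conj_set ?h diag_torus = T"
      using g by (simp add: T conj_set_mult conj_set_weyl_elt)
    ultimately show ?thesis
      using conj_set_g_mat_of_nonzero_corner[of ?h] g by (metis Sp_mult weyl_elt_Sp)
  qed
qed

section \<open>Quadratic characters of the units and characters of a split torus\<close>

lemma exists_nonsquare:
  assumes "odd CARD('p::prime_card)"
  shows "\<exists>n :: 'p mod_ring. \<nexists>y. n = y^2"
proof (rule ccontr)
  assume "\<not> ?thesis"
  hence "unit_squares = UNIV - {0 :: 'p mod_ring}" by (auto simp: unit_squares_def)
  \<comment> \<open>Squaring is two-to-one, so if it hit every unit, the number of units would equal
    its double.\<close>
  hence "complex_of_nat (card (UNIV - {0 :: 'p mod_ring})) = 2 * of_nat (card (UNIV - {0 :: 'p mod_ring}))"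
    using sum_over_unit_squares[OF assms, of "\<lambda>_. 1"] by (simp only: sum_constant mult_1_right)
  hence "card (UNIV - {0 :: 'p mod_ring}) = 0" by (metis mult_2 add_cancel_right_right of_nat_eq_0_iff)
  hence "UNIV - {0 :: 'p mod_ring} = {}" by (metis card_0_eq finite)
  moreover have "1 \<in> UNIV - {0 :: 'p mod_ring}" by simp
  ultimately show False by blast
qed

lemma sigma0_mult:
  fixes a b :: "'p::prime_card mod_ring"
  assumes "odd CARD('p)" "a \<noteq> 0" "b \<noteq> 0"
  shows "sigma0 (a * b) = sigma0 a * sigma0 b"
proof -
  have q: "(\<exists>z. y^2 * x = z^2) \<longleftrightarrow> (\<exists>z. x = z^2)" if "y \<noteq> 0" for x y :: "'p mod_ring"
  proof
    assume "\<exists>z. y^2 * x = z^2"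
    then obtain z where "y^2 * x = z^2" by blast
    hence "x = (z / y)^2" using that by (metis nonzero_mult_div_cancel_left power_divide power_not_zero)
    thus "\<exists>z. x = z^2" by blast
  qed (metis power_mult_distrib)
  consider y where "a = y^2" | y where "b = y^2" | "\<nexists>y. a = y^2" "\<nexists>y. b = y^2" by blast
  thus ?thesis
  proof cases
    case (1 y)
    thus ?thesis using assms q[of y b] by (auto simp: sigma0_eq)
  next
    case (2 y)
    thus ?thesis using assms q[of y a] by (auto simp: sigma0_eq mult.commute[of a])
  next
    case 3
    obtain y where "b = a * y^2" using nonsquare_eq_nonsquare_mult_square[OF assms(1) 3] by blast
    hence "a * b = (a * y)^2" by (simp add: power2_eq_square mult_ac)
    thus ?thesis using assms 3 by (auto simp: sigma0_eq)
  qed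
qed

text \<open>A character with values 1 and -1 is trivial on squares, and the nonsquares form one
  coset of them, so its value at a single nonsquare determines it. This resolves the definite
  description in \<open>order2_char\<close>.\<close>

lemma quadratic_unit_character_unique:
  fixes u :: "'p::prime_card mod_ring \<Rightarrow> complex"
  assumes odd: "odd CARD('p)" and mult: "\<And>a b. a \<noteq> 0 \<Longrightarrow> b \<noteq> 0 \<Longrightarrow> u (a * b) = u a * u b"
    and sq: "\<And>a. a \<noteq> 0 \<Longrightarrow> u a ^ 2 = 1" and n: "n \<noteq> 0" "u n \<noteq> 1" and a: "a \<noteq> 0"
  shows "u a = sigma0 a"
proof -
  have s: "u (y^2) = 1" if "y \<noteq> 0" for y
    using mult[OF that that] sq[OF that] by (simp add: power2_eq_square)
  have un: "u n = - 1" using sq[OF n(1)] n(2) by (simp add: power2_eq_1_iff)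
  have nn: "\<nexists>y. n = y^2" using s n by auto
  show ?thesis
  proof (cases "\<exists>y. a = y^2")
    case True
    thus ?thesis using a s by (auto simp: sigma0_eq)
  next
    case False
    then obtain y where y: "y \<noteq> 0" "a = n * y^2"
      using nonsquare_eq_nonsquare_mult_square[OF odd nn] by blast
    hence "u a = - 1" using mult[OF n(1), of "y^2"] s un by simp
    thus ?thesis using a False by (simp add: sigma0_eq)
  qed
qed

text \<open>The (1,1) entry recovers \<open>a\<close> from \<open>diag_elt a\<close>.\<close>

definition torus_char :: "'p::prime_card mat2 \<Rightarrow> ('p mod_ring \<Rightarrow> complex) \<Rightarrow> 'p mat2 \<Rightarrow> complex" where
  "torus_char g u = restrict (\<lambda>x. u ((matrix_inv g ** x ** g) $ 1 $ 1)) (conj_set g diag_torus)"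

lemma torus_char_conj_elt:
  assumes "g \<in> Sp" "a \<noteq> 0"
  shows "torus_char g u (conj_elt g a) = u a"
proof -
  have "matrix_inv g ** conj_elt g a ** g = matrix_inv g ** (conj_elt g a ** g)"
    by (simp add: matrix_mul_assoc)
  also have "\<dots> = (matrix_inv g ** g) ** diag_elt a"
    using assms by (simp add: conj_elt_mult_left matrix_mul_assoc)
  finally have "matrix_inv g ** conj_elt g a ** g = diag_elt a"
    using assms by (simp add: matrix_inv_inverse)
  moreover have "conj_elt g a \<in> conj_set g diag_torus"
    using assms by (simp add: conj_diag_torus)
  ultimately show ?thesis by (simp add: torus_char_def)
qed

lemma characters_conj_iff:
  assumes "g \<in> Sp"
  shows "\<eta> \<in> characters (conj_set g diag_torus) \<longleftrightarrow> \<eta> \<in> extensional (conj_set g diag_torus) \<and>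
    (\<forall>a. a \<noteq> 0 \<longrightarrow> \<eta> (conj_elt g a) \<noteq> 0) \<and>
    (\<forall>a b. a \<noteq> 0 \<longrightarrow> b \<noteq> 0 \<longrightarrow> \<eta> (conj_elt g (a * b)) = \<eta> (conj_elt g a) * \<eta> (conj_elt g b))"
  unfolding characters_def conj_diag_torus
  by (auto simp: PiE_def Pi_def conj_elt_mult[OF assms])

lemma torus_char_in_characters:
  assumes "g \<in> Sp" and "\<And>a. a \<noteq> 0 \<Longrightarrow> u a \<noteq> 0"
    and "\<And>a b. a \<noteq> 0 \<Longrightarrow> b \<noteq> 0 \<Longrightarrow> u (a * b) = u a * u b"
  shows "torus_char g u \<in> characters (conj_set g diag_torus)"
  unfolding characters_conj_iff[OF assms(1)]
  using assms by (simp add: torus_char_conj_elt) (simp add: torus_char_def)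

lemma character_eqI:
  assumes "g \<in> Sp" "\<eta> \<in> characters (conj_set g diag_torus)" "\<eta>' \<in> characters (conj_set g diag_torus)"
    and "\<And>a. a \<noteq> 0 \<Longrightarrow> \<eta> (conj_elt g a) = \<eta>' (conj_elt g a)"
  shows "\<eta> = \<eta>'"
proof (rule extensionalityI[of _ "conj_set g diag_torus"])
  show "\<eta> x = \<eta>' x" if "x \<in> conj_set g diag_torus" for x
    using that assms(4) by (auto simp: conj_diag_torus)
qed (use assms in \<open>auto simp: characters_conj_iff\<close>)

lemma order2_char_conj_elt:
  fixes g :: "'p::prime_card mat2"
  assumes odd: "odd CARD('p)" and g: "g \<in> Sp"
  shows "order2_char (conj_set g diag_torus) = torus_char g sigma0"
proof -
  let ?T = "conj_set g diag_torus"
  have T: "(\<forall>x\<in>?T. P x) \<longleftrightarrow> (\<forall>a. a \<noteq> 0 \<longrightarrow> P (conj_elt g a))"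
    "(\<exists>x\<in>?T. P x) \<longleftrightarrow> (\<exists>a. a \<noteq> 0 \<and> P (conj_elt g a))" for P
    by (auto simp: conj_diag_torus)
  obtain n :: "'p mod_ring" where n: "\<nexists>y. n = y^2" using exists_nonsquare[OF odd] by blast
  have n0: "n \<noteq> 0" using n by (metis zero_power2)
  have ch: "torus_char g sigma0 \<in> characters ?T"
    by (rule torus_char_in_characters[OF g]) (auto simp: sigma0_nonzero sigma0_mult[OF odd])
  show ?thesis
    unfolding order2_char_def
  proof (rule the_equality)
    show "torus_char g sigma0 \<in> characters ?T \<and> (\<exists>x\<in>?T. torus_char g sigma0 x \<noteq> 1) \<and>
        (\<forall>x\<in>?T. torus_char g sigma0 x ^ 2 = 1)"
    proof (intro conjI ch)
      show "\<exists>x\<in>?T. torus_char g sigma0 x \<noteq> 1"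
        unfolding T using n n0 by (intro exI[of _ n]) (simp add: torus_char_conj_elt[OF g] sigma0_eq)
      show "\<forall>x\<in>?T. torus_char g sigma0 x ^ 2 = 1"
        unfolding T by (simp add: torus_char_conj_elt[OF g] sigma0_eq)
    qed
  next
    fix \<eta> assume \<eta>: "\<eta> \<in> characters ?T \<and> (\<exists>x\<in>?T. \<eta> x \<noteq> 1) \<and> (\<forall>x\<in>?T. \<eta> x ^ 2 = 1)"
    then obtain m where m: "m \<noteq> 0" "\<eta> (conj_elt g m) \<noteq> 1" unfolding T by blast
    show "\<eta> = torus_char g sigma0"
    proof (rule character_eqI[OF g _ ch])
      fix a :: "'p mod_ring" assume a: "a \<noteq> 0"
      have "\<eta> (conj_elt g a) = sigma0 a"
        by (rule quadratic_unit_character_unique[OF odd, of "\<lambda>a. \<eta> (conj_elt g a)", OF _ _ m a])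
           (use \<eta> in \<open>auto simp: T characters_conj_iff[OF g]\<close>)
      thus "\<eta> (conj_elt g a) = torus_char g sigma0 (conj_elt g a)"
        by (simp add: torus_char_conj_elt[OF g a])
    qed (use \<eta> in blast)
  qed
qed

lemma eq_order2_char_iff:
  fixes g :: "'p::prime_card mat2"
  assumes odd: "odd CARD('p)" and g: "g \<in> Sp" and \<eta>: "\<eta> \<in> characters (conj_set g diag_torus)"
  shows "\<eta> = order2_char (conj_set g diag_torus) \<longleftrightarrow> (\<forall>a. a \<noteq> 0 \<longrightarrow> \<eta> (conj_elt g a) = sigma0 a)"
proof
  assume "\<eta> = order2_char (conj_set g diag_torus)"
  thus "\<forall>a. a \<noteq> 0 \<longrightarrow> \<eta> (conj_elt g a) = sigma0 a"
    by (simp add: order2_char_conj_elt[OF odd g] torus_char_conj_elt[OF g])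
next
  assume h: "\<forall>a. a \<noteq> 0 \<longrightarrow> \<eta> (conj_elt g a) = sigma0 a"
  have "torus_char g sigma0 \<in> characters (conj_set g diag_torus)"
    by (rule torus_char_in_characters[OF g]) (auto simp: sigma0_nonzero sigma0_mult[OF odd])
  thus "\<eta> = order2_char (conj_set g diag_torus)"
    unfolding order2_char_conj_elt[OF odd g]
    using h by (intro character_eqI[OF g \<eta>]) (simp_all add: torus_char_conj_elt[OF g])
qed

subsection \<open>Eigenvectors of split tori\<close>

lemma eigenspace_conj_iff:
  "f \<in> eigenspace \<rho> (conj_set g diag_torus) \<eta> \<longleftrightarrow>
    (\<forall>a. a \<noteq> 0 \<longrightarrow> \<rho> (conj_elt g a) f = \<eta> (conj_elt g a) *s f)"
  by (auto simp: eigenspace_def conj_diag_torus)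

lemma conj_set_mat_1: "conj_set (mat 1) diag_torus = diag_torus"
  unfolding conj_diag_torus by (simp add: conj_elt_mat_1 diag_torus_eq)

lemma weil_rep_mem_eigenspace_iff:
  assumes \<rho>: "weil_representation \<rho>" and g: "g \<in> Sp"
    and "\<And>a. a \<noteq> 0 \<Longrightarrow> \<eta> (conj_elt g a) = \<eta>' (diag_elt a)"
  shows "\<rho> g f \<in> eigenspace \<rho> (conj_set g diag_torus) \<eta> \<longleftrightarrow> f \<in> eigenspace \<rho> diag_torus \<eta>'"
proof -
  have "\<rho> (conj_elt g a) (\<rho> g f) = \<eta> (conj_elt g a) *s \<rho> g f \<longleftrightarrow>
      \<rho> (diag_elt a) f = \<eta>' (diag_elt a) *s f" if a: "a \<noteq> 0" for a
  proof -
    have "\<rho> (conj_elt g a) (\<rho> g f) = \<rho> g (\<rho> (diag_elt a) f)"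
      using conj_elt_mult_left[OF g, of a] g a
      by (metis weil_rep_mult[OF \<rho>] conj_elt_Sp diag_elt_Sp)
    thus ?thesis
      by (simp add: assms(3)[OF a] weil_rep_inject[OF \<rho> g] flip: weil_rep_scale[OF \<rho> g])
  qed
  thus ?thesis
    using eigenspace_conj_iff[of "\<rho> g f" \<rho> g \<eta>] eigenspace_conj_iff[of f \<rho> "mat 1" \<eta>']
    by (simp add: conj_set_mat_1 conj_elt_mat_1)
qed

text \<open>The units act transitively on themselves, so an eigenvector is determined off 0 by its
  value at 1. At 0 a torus element where \<eta> differs from the Legendre character forces the value
  0.\<close>

lemma diag_eigenspace_one_dim:
  fixes \<rho> :: "'p::prime_card mat2 \<Rightarrow> _"
  assumes odd: "odd CARD('p)" and \<rho>: "weil_representation \<rho>"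
    and \<eta>: "\<eta> \<in> characters diag_torus" "\<eta> \<noteq> order2_char diag_torus"
    and f: "f \<in> eigenspace \<rho> diag_torus \<eta>" "herm f f = 1"
    and f': "f' \<in> eigenspace \<rho> diag_torus \<eta>" "herm f' f' = 1"
  shows "\<exists>z. cmod z = 1 \<and> z *s f = f'"
proof -
  \<comment> \<open>The numerator is 0 at t = 0, so \<open>k\<close> vanishes there whatever \<eta>
    takes at \<open>diag_elt 0\<close>, which lies outside the torus.\<close>
  define k :: "'p hilb" where "k = (\<chi> t. sigma0 t / \<eta> (diag_elt t))"
  have nz: "\<eta> (diag_elt a) \<noteq> 0" if "a \<noteq> 0" for a
    using \<eta>(1) that characters_conj_iff[of "mat 1" \<eta>] by (simp add: conj_set_mat_1 conj_elt_mat_1)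
  obtain a where a: "a \<noteq> 0" "\<eta> (diag_elt a) \<noteq> sigma0 a"
    using \<eta> eq_order2_char_iff[OF odd, of "mat 1" \<eta>] by (auto simp: conj_set_mat_1 conj_elt_mat_1)
  have h: "h = (h $ 1) *s k" if "h \<in> eigenspace \<rho> diag_torus \<eta>" for h
  proof -
    have "\<rho> (diag_elt a) h = \<eta> (diag_elt a) *s h" if "a \<noteq> 0" for a
      using \<open>h \<in> _\<close> that by (simp add: eigenspace_def diag_torus_eq)
    hence e: "sigma0 a * h $ (inverse a * t) = \<eta> (diag_elt a) * h $ t" if "a \<noteq> 0" for a t
      using that by (simp add: weil_rep_diag[OF odd \<rho>] S_op_def vec_eq_iff)
    have "h $ t = h $ 1 * k $ t" for t
    proof (cases "t = 0")
      case True
      thus ?thesis using e[OF a(1), of 0] a(2) by (simp add: k_def sigma0_eq)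
    next
      case False
      thus ?thesis using e[OF False, of t] nz[OF False] by (simp add: k_def field_simps)
    qed
    thus ?thesis unfolding vec_eq_iff vector_smult_component by blast
  qed
  let ?c = "f $ 1" and ?c' = "f' $ 1"
  have "?c \<noteq> 0"
  proof
    assume "?c = 0"
    hence "f = 0" using h[OF f(1)] by (metis vector_smult_lzero)
    thus False using f(2) by (simp add: herm_def)
  qed
  hence z: "(?c' / ?c) *s f = f'"
    using h[OF f(1)] h[OF f'(1)] by (metis vector_smult_assoc nonzero_eq_divide_eq)
  hence "complex_of_real ((cmod (?c' / ?c))^2) = 1"
    using herm_scale[of "?c' / ?c" f] f(2) f'(2) by simp
  hence "(cmod (?c' / ?c))^2 = 1" using of_real_eq_1_iff by blast
  hence "cmod (?c' / ?c) = 1"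
    by (simp add: power2_eq_1_iff) (metis norm_ge_zero neg_0_le_iff_le not_one_le_zero)
  thus ?thesis using z by blast
qed

text \<open>Transport of a character between two tori by matching their parameters. With
  \<open>h = mat 1\<close> it descends to A, with \<open>g = mat 1\<close> it lifts from A, and the
  two are mutually inverse.\<close>

definition conj_char :: "'p::prime_card mat2 \<Rightarrow> 'p mat2 \<Rightarrow> ('p mat2 \<Rightarrow> complex) \<Rightarrow> 'p mat2 \<Rightarrow> complex" where
  "conj_char g h \<eta> = torus_char h (\<lambda>a. \<eta> (conj_elt g a))"

lemma conj_char_conj_elt:
  "h \<in> Sp \<Longrightarrow> a \<noteq> 0 \<Longrightarrow> conj_char g h \<eta> (conj_elt h a) = \<eta> (conj_elt g a)"
  by (simp add: conj_char_def torus_char_conj_elt)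

lemma conj_char_in_characters:
  assumes "g \<in> Sp" "h \<in> Sp" "\<eta> \<in> characters (conj_set g diag_torus)"
  shows "conj_char g h \<eta> \<in> characters (conj_set h diag_torus)"
  unfolding conj_char_def
  by (rule torus_char_in_characters[OF assms(2)])
     (use assms(3) in \<open>auto simp: characters_conj_iff[OF assms(1)]\<close>)

lemma conj_char_eq_order2_iff:
  fixes g :: "'p::prime_card mat2"
  assumes "odd CARD('p)" "g \<in> Sp" "h \<in> Sp" "\<eta> \<in> characters (conj_set g diag_torus)"
  shows "conj_char g h \<eta> = order2_char (conj_set h diag_torus) \<longleftrightarrow> \<eta> = order2_char (conj_set g diag_torus)"
  using assms by (simp add: eq_order2_char_iff conj_char_in_characters conj_char_conj_elt)

lemma conj_char_inverse:
  assumes "g \<in> Sp" "h \<in> Sp" "\<eta> \<in> characters (conj_set g diag_torus)"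
  shows "conj_char h g (conj_char g h \<eta>) = \<eta>"
  by (rule character_eqI[OF assms(1)]) (use assms in \<open>simp_all add: conj_char_in_characters conj_char_conj_elt\<close>)

text \<open>Uniqueness up to a phase is available over A, so the chosen vector of the torus is
  pulled back through \<open>\<rho> g\<close> and compared there; unitarity keeps its norm
  1.\<close>

lemma weil_rep_transports_eigenvector:
  fixes \<rho> :: "'p::prime_card mat2 \<Rightarrow> _"
  assumes odd: "odd CARD('p)" and \<rho>: "weil_representation \<rho>" and \<phi>: "unit_eigenvectors \<rho> \<phi>"
    and g: "g \<in> Sp" and \<eta>: "\<eta> \<in> characters (conj_set g diag_torus)"
      "\<eta> \<noteq> order2_char (conj_set g diag_torus)"
  shows "\<exists>z. cmod z = 1 \<and> z *s \<phi> (conj_set g diag_torus) \<eta> = \<rho> g (\<phi> diag_torus (conj_char g (mat 1) \<eta>))"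
proof -
  let ?T = "conj_set g diag_torus" and ?\<eta>' = "conj_char g (mat 1) \<eta>"
  have split: "split_torus ?T" using g by (auto simp: split_torus_def)
  have splitA: "split_torus (diag_torus :: 'p mat2 set)"
    using conj_set_mat_1 mat_1_Sp unfolding split_torus_def by metis
  have \<eta>': "?\<eta>' \<in> characters diag_torus" "?\<eta>' \<noteq> order2_char diag_torus"
    using conj_char_in_characters[OF g mat_1_Sp \<eta>(1)] conj_char_eq_order2_iff[OF odd g mat_1_Sp \<eta>(1)] \<eta>(2)
    by (auto simp: conj_set_mat_1)
  have v: "\<phi> ?T \<eta> \<in> eigenspace \<rho> ?T \<eta>" "herm (\<phi> ?T \<eta>) (\<phi> ?T \<eta>) = 1"
    using \<phi> split \<eta> unfolding unit_eigenvectors_def by blast+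
  have v': "\<phi> diag_torus ?\<eta>' \<in> eigenspace \<rho> diag_torus ?\<eta>'" "herm (\<phi> diag_torus ?\<eta>') (\<phi> diag_torus ?\<eta>') = 1"
    using \<phi> splitA \<eta>' unfolding unit_eigenvectors_def by blast+
  obtain f where f: "\<rho> g f = \<phi> ?T \<eta>"
    using weil_rep_intertwines(2)[OF \<rho> g] by (metis bij_pointE)
  have "\<eta> (conj_elt g a) = ?\<eta>' (diag_elt a)" if "a \<noteq> 0" for a
    using conj_char_conj_elt[OF mat_1_Sp that, of g \<eta>] by (simp add: conj_elt_mat_1)
  hence "f \<in> eigenspace \<rho> diag_torus ?\<eta>'"
    using weil_rep_mem_eigenspace_iff[OF \<rho> g, of \<eta> ?\<eta>' f] v(1) f by simp
  moreover have "herm f f = 1"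
    using v(2) weil_rep_intertwines(3)[OF \<rho> g, of f f] f by simp
  ultimately obtain z where "cmod z = 1" "z *s f = \<phi> diag_torus ?\<eta>'"
    using diag_eigenspace_one_dim[OF odd \<rho> \<eta>' _ _ v'] by blast
  thus ?thesis using f weil_rep_scale[OF \<rho> g, of z f] by metis
qed

lemma split_oscillator_system_eq:
  fixes \<rho> :: "'p::prime_card mat2 \<Rightarrow> _"
  assumes odd: "odd CARD('p)" and \<rho>: "weil_representation \<rho>" and \<phi>: "unit_eigenvectors \<rho> \<phi>"
    and R: "R \<subseteq> Sp" "\<And>T. split_torus T \<Longrightarrow> \<exists>!g. g \<in> R \<and> T = conj_set g diag_torus"
  shows "\<exists>\<zeta>. (\<forall>T \<eta>. cmod (\<zeta> T \<eta>) = 1) \<and>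
    split_oscillator_system (\<lambda>T \<eta>. \<zeta> T \<eta> *s \<phi> T \<eta>) = {\<rho> g f | g f. g \<in> R \<and> f \<in> torus_basis \<phi> diag_torus}"
proof -
  \<comment> \<open>The phase is chosen before g, so that it depends on the pair alone; this is
    possible because R contains only one g for the torus.\<close>
  have "\<exists>z. cmod z = 1 \<and> (\<forall>g\<in>R. T = conj_set g diag_torus \<and> \<eta> \<in> characters T \<and> \<eta> \<noteq> order2_char T \<longrightarrow>
      z *s \<phi> T \<eta> = \<rho> g (\<phi> diag_torus (conj_char g (mat 1) \<eta>)))" for T \<eta>
  proof (cases "\<exists>g\<in>R. T = conj_set g diag_torus \<and> \<eta> \<in> characters T \<and> \<eta> \<noteq> order2_char T")
    case True
    then obtain g where g: "g \<in> R" "T = conj_set g diag_torus" "\<eta> \<in> characters T" "\<eta> \<noteq> order2_char T"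
      by blast
    hence "g \<in> Sp" using R(1) by blast
    hence "split_torus T" using g by (auto simp: split_torus_def)
    hence "h = g" if "h \<in> R" "T = conj_set h diag_torus" for h
      using R(2)[of T] g that by blast
    moreover obtain z where "cmod z = 1" "z *s \<phi> T \<eta> = \<rho> g (\<phi> diag_torus (conj_char g (mat 1) \<eta>))"
      using weil_rep_transports_eigenvector[OF odd \<rho> \<phi> \<open>g \<in> Sp\<close>, of \<eta>] g by blast
    ultimately show ?thesis by blast
  next
    case False
    \<comment> \<open>Pairs that contribute no vector get the default phase 1, so the phases are
      unitary everywhere.\<close>
    thus ?thesis by (intro exI[of _ 1]) auto
  qed
  then obtain \<zeta> where \<zeta>: "\<And>T \<eta>. cmod (\<zeta> T \<eta>) = 1"
    and eq: "\<And>T \<eta> g. g \<in> R \<Longrightarrow> T = conj_set g diag_torus \<Longrightarrow> \<eta> \<in> characters T \<Longrightarrow> \<eta> \<noteq> order2_char T \<Longrightarrow>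
      \<zeta> T \<eta> *s \<phi> T \<eta> = \<rho> g (\<phi> diag_torus (conj_char g (mat 1) \<eta>))"
    by metis
  have "split_oscillator_system (\<lambda>T \<eta>. \<zeta> T \<eta> *s \<phi> T \<eta>) = {\<rho> g f | g f. g \<in> R \<and> f \<in> torus_basis \<phi> diag_torus}"
  proof (intro equalityI subsetI)
    fix v assume "v \<in> split_oscillator_system (\<lambda>T \<eta>. \<zeta> T \<eta> *s \<phi> T \<eta>)"
    then obtain T \<eta> where T: "split_torus T" and \<eta>: "\<eta> \<in> characters T" "\<eta> \<noteq> order2_char T"
      and v: "v = \<zeta> T \<eta> *s \<phi> T \<eta>"
      by (auto simp: split_oscillator_system_def torus_basis_def)
    obtain g where g: "g \<in> R" "T = conj_set g diag_torus" using R(2)[OF T] by blast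
    hence gS: "g \<in> Sp" using R(1) by blast
    have "conj_char g (mat 1) \<eta> \<in> characters diag_torus" "conj_char g (mat 1) \<eta> \<noteq> order2_char diag_torus"
      using conj_char_in_characters[OF gS mat_1_Sp, of \<eta>] conj_char_eq_order2_iff[OF odd gS mat_1_Sp, of \<eta>] \<eta> g
      by (auto simp: conj_set_mat_1)
    hence "\<phi> diag_torus (conj_char g (mat 1) \<eta>) \<in> torus_basis \<phi> diag_torus"
      by (auto simp: torus_basis_def)
    thus "v \<in> {\<rho> g f | g f. g \<in> R \<and> f \<in> torus_basis \<phi> diag_torus}"
      unfolding v eq[OF g \<eta>] using g(1) by blast
  next
    fix v assume "v \<in> {\<rho> g f | g f. g \<in> R \<and> f \<in> torus_basis \<phi> diag_torus}"
    then obtain g \<eta>' where g: "g \<in> R" and \<eta>': "\<eta>' \<in> characters diag_torus" "\<eta>' \<noteq> order2_char diag_torus"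
      and v: "v = \<rho> g (\<phi> diag_torus \<eta>')"
      by (auto simp: torus_basis_def)
    have gS: "g \<in> Sp" using g R(1) by blast
    define \<eta> where "\<eta> = conj_char (mat 1) g \<eta>'"
    have \<eta>: "\<eta> \<in> characters (conj_set g diag_torus)" "\<eta> \<noteq> order2_char (conj_set g diag_torus)"
      unfolding \<eta>_def
      using conj_char_in_characters[OF mat_1_Sp gS, of \<eta>'] conj_char_eq_order2_iff[OF odd mat_1_Sp gS, of \<eta>'] \<eta>'
      by (auto simp: conj_set_mat_1)
    have "conj_char g (mat 1) \<eta> = \<eta>'"
      unfolding \<eta>_def using \<eta>'(1) by (intro conj_char_inverse mat_1_Sp gS) (simp add: conj_set_mat_1)
    hence "v = \<zeta> (conj_set g diag_torus) \<eta> *s \<phi> (conj_set g diag_torus) \<eta>"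
      using eq[OF g refl \<eta>] v by simp
    moreover have "split_torus (conj_set g diag_torus)" using gS by (auto simp: split_torus_def)
    ultimately show "v \<in> split_oscillator_system (\<lambda>T \<eta>. \<zeta> T \<eta> *s \<phi> T \<eta>)"
      using \<eta> by (auto simp: split_oscillator_system_def torus_basis_def)
  qed
  thus ?thesis using \<zeta> by blast
qed

theorem mainTheorem6:
  assumes "odd CARD('p::prime_card)"
  shows "(\<forall>T :: 'p mat2 set. split_torus T \<longrightarrow> (\<exists>b c. T = conj_set (g_mat b c) diag_torus)) \<and>
    (\<forall>\<rho> :: 'p mat2 \<Rightarrow> 'p hilb \<Rightarrow> 'p hilb. weil_representation \<rho> \<longrightarrow>
       (\<forall>\<phi> R. unit_eigenvectors \<rho> \<phi> \<and> R \<subseteq> {g_mat b c | b c. True} \<and>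
            (\<forall>T. split_torus T \<longrightarrow> (\<exists>!g. g \<in> R \<and> T = conj_set g diag_torus)) \<longrightarrow>
            (\<exists>\<zeta>. (\<forall>T \<eta>. cmod (\<zeta> T \<eta>) = 1) \<and>
                 split_oscillator_system (\<lambda>T \<eta>. \<zeta> T \<eta> *s \<phi> T \<eta>) =
                   {\<rho> g f | g f. g \<in> R \<and> f \<in> torus_basis \<phi> diag_torus})) \<and>
       (\<forall>b c. b \<noteq> 0 \<longrightarrow>
            eq_up_to_unitary_scalar (\<rho> (g_mat b c))
              (M_op ((1 + b * c) / b) \<circ> S_op b \<circ> F_op \<circ> M_op (inverse b))) \<and>
       (\<forall>c. eq_up_to_unitary_scalar (\<rho> (g_mat 0 c)) (M_op c)))"
proof (intro conjI allI impI)
  fix T :: "'p mat2 set"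
  assume "split_torus T"
  thus "\<exists>b c. T = conj_set (g_mat b c) diag_torus" by (rule split_torus_eq_g_mat)
next
  fix \<rho> :: "'p mat2 \<Rightarrow> 'p hilb \<Rightarrow> 'p hilb" and \<phi> and R :: "'p mat2 set"
  assume \<rho>: "weil_representation \<rho>" and
    *: "unit_eigenvectors \<rho> \<phi> \<and> R \<subseteq> {g_mat b c | b c. True} \<and>
      (\<forall>T. split_torus T \<longrightarrow> (\<exists>!g. g \<in> R \<and> T = conj_set g diag_torus))"
  have "R \<subseteq> Sp" using * by auto
  thus "\<exists>\<zeta>. (\<forall>T \<eta>. cmod (\<zeta> T \<eta>) = 1) \<and>
      split_oscillator_system (\<lambda>T \<eta>. \<zeta> T \<eta> *s \<phi> T \<eta>) =
        {\<rho> g f | g f. g \<in> R \<and> f \<in> torus_basis \<phi> diag_torus}"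
    using * by (intro split_oscillator_system_eq[OF assms \<rho>]) blast+
qed (rule weil_rep_g_mat[OF assms] weil_rep_lower[OF assms]; assumption)+

end
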